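(* Let $X_n=(\mathbb{C}^n,\|\cdot\|)$ be a Banach lattice and let $J\subset\Lambda(m,n)$ be an index set. Then $$\boldsymbol{gl}\big(\mathcal{P}_J(X_n)\big)\le e\,\|\mathbf{Q}_{\Lambda(m,n),J}\|\,\boldsymbol{\lambda}\big(\mathcal{P}_{J^\flat}(X_n)\big).$$ Moreover, if $J\subset\mathbb{N}_0^n$ is an index set of degree $m$, then $$\boldsymbol{gl}\big(\mathcal{P}_J(X_n)\big)\le e(m+1)\max_{1\le k\le m}\|\mathbf{Q}_{\Lambda(k,n),J(k)}\|\,\max_{1\le k\le m}\boldsymbol{\lambda}\big(\mathcal{P}_{J(k)^\flat}(X_n)\big).$$
   Context: A Banach lattice $X_n=(\mathbb{C}^n,\|\cdot\|)$ is a norm on $\mathbb{C}^n$ with $\|z\|\le\|w\|$ whenever $|z_k|\le|w_k|$ for all $k$. $\Lambda(k,n)=\{\alpha\in\mathbb{N}_0^n:|\alpha|=k\}$; for $J\subset\mathbb{N}_0^n$, $J(k)=J\cap\Lambda(k,n)$; $J$ has degree $m$ if $|\alpha|\le m$ for all $\alpha\in J$ (with $m$ the maximal order). For $J\subset\Lambda(m,n)$, the reduced set $J^\flat\subset\Lambda(m-1,n)$ consists of all $\alpha\in\Lambda(m-1,n)$ such that $\alpha+e_k\in J$ for some $1\le k\le n$. $\mathcal{P}_J(X_n)$ is the space of polynomials $\sum_{\alpha\in J}c_\alpha z^\alpha$ with norm $\sup_{z\in B_{X_n}}|P(z)|$. For $I\subset J'$, $\mathbf{Q}_{J',I}:\mathcal{P}_{J'}(X_n)\to\mathcal{P}_I(X_n)$,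 $\sum_{\alpha\in J'}c_\alpha z^\alpha\mapsto\sum_{\alpha\in I}c_\alpha z^\alpha$. $\boldsymbol{\lambda}$ is the projection constant. For an operator $u:E\to F$ between finite-dimensional spaces, $\pi_1(u)$ is its 1-summing norm (least $C$ with $\sum_j\|ux_j\|\le C\sup_{\|x^*\|\le1}\sum_j|x^*(x_j)|$ for all finite families) and $\gamma_1(u)=\inf\|v\|\|w\|$ over factorizations $u=wv$ with $v:E\to\ell_1^N$, $w:\ell_1^N\to F$. The Gordon–Lewis constant $\boldsymbol{gl}(E)$ is the least $C$ with $\gamma_1(u)\le C\pi_1(u)$ for all operators $u:E\to\ell_2$. *)

theory Defs
  imports Complex_Main
begin

text \<open>A finite-dimensional complex normed space is modelled as the space of
coefficient functions supported on a finite index set S, equipped with a norm p.\<close>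

definition fvec :: "'a set \<Rightarrow> ('a \<Rightarrow> complex) set" where
  "fvec S = {x. \<forall>a. a \<notin> S \<longrightarrow> x a = 0}"

definition is_op :: "'a set \<Rightarrow> 'b set \<Rightarrow> (('a \<Rightarrow> complex) \<Rightarrow> ('b \<Rightarrow> complex)) \<Rightarrow> bool" where
  "is_op S T u \<longleftrightarrow>
     (\<forall>x\<in>fvec S. u x \<in> fvec T) \<and>
     (\<forall>x\<in>fvec S. \<forall>y\<in>fvec S. u (\<lambda>a. x a + y a) = (\<lambda>b. u x b + u y b)) \<and>
     (\<forall>c. \<forall>x\<in>fvec S. u (\<lambda>a. c * x a) = (\<lambda>b. c * u x b))"

definition opnorm :: "'a set \<Rightarrow> (('a \<Rightarrow> complex) \<Rightarrow> real) \<Rightarrow> 'b set \<Rightarrow> (('b \<Rightarrow> complex) \<Rightarrow> real)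
    \<Rightarrow> (('a \<Rightarrow> complex) \<Rightarrow> ('b \<Rightarrow> complex)) \<Rightarrow> real" where
  "opnorm S p T q u = Sup {q (u x) | x. x \<in> fvec S \<and> p x \<le> 1}"

definition lin_functional :: "'a set \<Rightarrow> (('a \<Rightarrow> complex) \<Rightarrow> complex) \<Rightarrow> bool" where
  "lin_functional S \<phi> \<longleftrightarrow>
     (\<forall>x\<in>fvec S. \<forall>y\<in>fvec S. \<phi> (\<lambda>a. x a + y a) = \<phi> x + \<phi> y) \<and>
     (\<forall>c. \<forall>x\<in>fvec S. \<phi> (\<lambda>a. c * x a) = c * \<phi> x)"

definition dual_ball :: "'a set \<Rightarrow> (('a \<Rightarrow> complex) \<Rightarrow> real) \<Rightarrow> (('a \<Rightarrow> complex) \<Rightarrow> complex) set" where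
  "dual_ball S p = {\<phi>. lin_functional S \<phi> \<and> (\<forall>x\<in>fvec S. cmod (\<phi> x) \<le> p x)}"

definition l1norm :: "nat \<Rightarrow> (nat \<Rightarrow> complex) \<Rightarrow> real" where
  "l1norm N x = (\<Sum>i<N. cmod (x i))"

definition l2norm :: "nat \<Rightarrow> (nat \<Rightarrow> complex) \<Rightarrow> real" where
  "l2norm N x = sqrt (\<Sum>i<N. (cmod (x i))\<^sup>2)"

definition pi1 :: "'a set \<Rightarrow> (('a \<Rightarrow> complex) \<Rightarrow> real) \<Rightarrow> 'b set \<Rightarrow> (('b \<Rightarrow> complex) \<Rightarrow> real)
    \<Rightarrow> (('a \<Rightarrow> complex) \<Rightarrow> ('b \<Rightarrow> complex)) \<Rightarrow> real" where
  "pi1 S p T q u = Inf {C. 0 \<le> C \<and>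
      (\<forall>(k::nat) xs. (\<forall>j<k. xs j \<in> fvec S) \<longrightarrow>
         (\<Sum>j<k. q (u (xs j))) \<le> C * Sup {\<Sum>j<k. cmod (\<phi> (xs j)) | \<phi>. \<phi> \<in> dual_ball S p})}"

definition gamma1 :: "'a set \<Rightarrow> (('a \<Rightarrow> complex) \<Rightarrow> real) \<Rightarrow> 'b set \<Rightarrow> (('b \<Rightarrow> complex) \<Rightarrow> real)
    \<Rightarrow> (('a \<Rightarrow> complex) \<Rightarrow> ('b \<Rightarrow> complex)) \<Rightarrow> real" where
  "gamma1 S p T q u = Inf {opnorm S p {..<N} (l1norm N) v * opnorm {..<N} (l1norm N) T q w
      | N v w. is_op S {..<N} v \<and> is_op {..<N} T w \<and> (\<forall>x\<in>fvec S. w (v x) = u x)}"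

text \<open>Gordon--Lewis constant (operators into l_2, realised as l_2^M for all M)\<close>
definition gl_const :: "'a set \<Rightarrow> (('a \<Rightarrow> complex) \<Rightarrow> real) \<Rightarrow> real" where
  "gl_const S p = Inf {C. 0 \<le> C \<and>
      (\<forall>(M::nat) u. is_op S {..<M} u \<longrightarrow>
         gamma1 S p {..<M} (l2norm M) u \<le> C * pi1 S p {..<M} (l2norm M) u)}"

text \<open>Projection constant, realised as the relative projection constant of E
  in l_infinity(B_{E*}) (E embedded isometrically via x \<mapsto> (x* \<mapsto> x*(x))).\<close>
definition linf :: "'c set \<Rightarrow> ('c \<Rightarrow> complex) set" where
  "linf K = {f \<in> fvec K. \<exists>B. \<forall>k\<in>K. cmod (f k) \<le> B}"

definition supnorm :: "'c set \<Rightarrow> ('c \<Rightarrow> complex) \<Rightarrow> real" where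
  "supnorm K f = Sup {cmod (f k) | k. k \<in> K}"

definition dual_emb :: "'a set \<Rightarrow> (('a \<Rightarrow> complex) \<Rightarrow> real) \<Rightarrow> ('a \<Rightarrow> complex)
    \<Rightarrow> ((('a \<Rightarrow> complex) \<Rightarrow> complex) \<Rightarrow> complex)" where
  "dual_emb S p x = (\<lambda>\<phi>. if \<phi> \<in> dual_ball S p then \<phi> x else 0)"

definition is_projection :: "'a set \<Rightarrow> (('a \<Rightarrow> complex) \<Rightarrow> real)
    \<Rightarrow> (((('a \<Rightarrow> complex) \<Rightarrow> complex) \<Rightarrow> complex) \<Rightarrow> ('a \<Rightarrow> complex)) \<Rightarrow> bool" where
  "is_projection S p P \<longleftrightarrow>
     (let K = dual_ball S p in
       (\<forall>f\<in>linf K. P f \<in> fvec S) \<and>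
       (\<forall>f\<in>linf K. \<forall>g\<in>linf K. P (\<lambda>k. f k + g k) = (\<lambda>a. P f a + P g a)) \<and>
       (\<forall>c. \<forall>f\<in>linf K. P (\<lambda>k. c * f k) = (\<lambda>a. c * P f a)) \<and>
       (\<exists>B. \<forall>f\<in>linf K. p (P f) \<le> B * supnorm K f) \<and>
       (\<forall>x\<in>fvec S. P (dual_emb S p x) = x))"

definition proj_const :: "'a set \<Rightarrow> (('a \<Rightarrow> complex) \<Rightarrow> real) \<Rightarrow> real" where
  "proj_const S p = Inf {Sup {p (P f) | f. f \<in> linf (dual_ball S p) \<and> supnorm (dual_ball S p) f \<le> 1}
      | P. is_projection S p P}"

text \<open>C^n is modelled as functions from a finite type 'n (with n = CARD('n)) to complex.\<close>
definition banach_lattice :: "(('n::finite \<Rightarrow> complex) \<Rightarrow> real) \<Rightarrow> bool" where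
  "banach_lattice N \<longleftrightarrow>
     (\<forall>z. 0 \<le> N z) \<and> (\<forall>z. N z = 0 \<longleftrightarrow> z = (\<lambda>_. 0)) \<and>
     (\<forall>c z. N (\<lambda>i. c * z i) = cmod c * N z) \<and>
     (\<forall>z w. N (\<lambda>i. z i + w i) \<le> N z + N w) \<and>
     (\<forall>z w. (\<forall>k. cmod (z k) \<le> cmod (w k)) \<longrightarrow> N z \<le> N w)"

definition order :: "('n::finite \<Rightarrow> nat) \<Rightarrow> nat" where
  "order \<alpha> = (\<Sum>i\<in>UNIV. \<alpha> i)"

definition Lambda :: "nat \<Rightarrow> ('n::finite \<Rightarrow> nat) set" where
  "Lambda k = {\<alpha>. order \<alpha> = k}"

definition Jpart :: "('n::finite \<Rightarrow> nat) set \<Rightarrow> nat \<Rightarrow> ('n \<Rightarrow> nat) set" where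
  "Jpart J k = J \<inter> Lambda k"

definition flat :: "nat \<Rightarrow> ('n::finite \<Rightarrow> nat) set \<Rightarrow> ('n \<Rightarrow> nat) set" where
  "flat m J = {\<alpha> \<in> Lambda (m - 1). \<exists>k. \<alpha>(k := \<alpha> k + 1) \<in> J}"

definition monom :: "('n::finite \<Rightarrow> complex) \<Rightarrow> ('n \<Rightarrow> nat) \<Rightarrow> complex" where
  "monom z \<alpha> = (\<Prod>i\<in>UNIV. z i ^ \<alpha> i)"

text \<open>norm of P_J(X_n): the polynomial with coefficients c (supported on J) is
  sum over J of c_alpha z^alpha; norm = sup over the unit ball of X_n\<close>
definition poly_norm :: "(('n::finite \<Rightarrow> complex) \<Rightarrow> real) \<Rightarrow> ('n \<Rightarrow> nat) set
    \<Rightarrow> (('n \<Rightarrow> nat) \<Rightarrow> complex) \<Rightarrow> real" where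
  "poly_norm N J c = Sup {cmod (\<Sum>\<alpha>\<in>J. c \<alpha> * monom z \<alpha>) | z. N z \<le> 1}"

definition Qmap :: "('n::finite \<Rightarrow> nat) set \<Rightarrow> (('n \<Rightarrow> nat) \<Rightarrow> complex) \<Rightarrow> (('n \<Rightarrow> nat) \<Rightarrow> complex)" where
  "Qmap I c = (\<lambda>\<alpha>. if \<alpha> \<in> I then c \<alpha> else 0)"

definition Qnorm :: "(('n::finite \<Rightarrow> complex) \<Rightarrow> real) \<Rightarrow> ('n \<Rightarrow> nat) set \<Rightarrow> ('n \<Rightarrow> nat) set \<Rightarrow> real" where
  "Qnorm N J' I = opnorm J' (poly_norm N J') I (poly_norm N I) (Qmap I)"

definition gl_poly :: "(('n::finite \<Rightarrow> complex) \<Rightarrow> real) \<Rightarrow> ('n \<Rightarrow> nat) set \<Rightarrow> real" where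
  "gl_poly N J = gl_const J (poly_norm N J)"

definition lambda_poly :: "(('n::finite \<Rightarrow> complex) \<Rightarrow> real) \<Rightarrow> ('n \<Rightarrow> nat) set \<Rightarrow> real" where
  "lambda_poly N J = proj_const J (poly_norm N J)"

end

(* Euler's identity writes a homogeneous polynomial c of degree m as the sum over k of Q(z_k D_k c),
   where D_k = (1/m) d/dz_k maps P_J into P_{J-flat} and Q projects onto P_J. Embed P_{J-flat} into
   l_infinity(K), K its dual ball, with a projection P back. On l_infinity(K) a summing operator
   factors through l_1: an operator u on P_J is approximated by
      c |-> sum_{k,l} l(D_k c) u(Q(z_k P(1_{r = l}))),
   with r : K -> K of finite range and close to the identity on coefficients, and the pi_1-norm of u
   bounds the l_1-norm of this factorization by
      ||Q|| ||P|| sup_{w,z} |sum_k w_k (D_k c)(z)|,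
   w and z in the unit ball; the lattice property absorbs the signs into w. Cauchy's estimate for
   t |-> c(z + t w) on |t| = 1/m bounds the supremum by (1 + 1/m)^m ||c|| <= e ||c||.
   In the inhomogeneous case u is the sum of its restrictions to the m + 1 homogeneous parts, and the
   projections onto those have norm at most 1. *)

theory Submission
  imports Defs "HOL-Complex_Analysis.Complex_Analysis"
begin

hide_const (open) Polynomial.order Polynomial.monom

subsection \<open>Coordinate spaces and operators\<close>

text \<open>The factorization demanded by \<open>gamma1\<close> passes through a finite-dimensional
  l_1, whereas \<open>linf K\<close> over the dual ball is in general infinite-dimensional. This
  forces the finite-range map \<open>r\<close>, and with it an error operator that has to be
  factored as well. Since \<open>pi1\<close> and the projection constant are infima, factorizations
  are built for an arbitrary admissible summing constant, a nearly optimal projection and an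
  arbitrary \<epsilon>. The l_1-norm is estimated by moving the weights |l (D_k c)| onto the
  vectors: it becomes a sum of norms of \<open>u\<close> at finitely many polynomials, and the
  summing property leaves only the norms of their signed sums to be bounded. Such a sum has the form
  Q(sum_k z_k P(g_k)). At a fixed point z the numbers z_k are scalars and pass through the linear
  \<open>P\<close>, so that one application of \<open>P\<close> serves all variables and no factor
  depending on their number appears. The radius 1/m in Cauchy's estimate is chosen so that the
  resulting factor m cancels the normalization of D_k. The part of degree zero has neither an Euler
  identity nor a term in the two maxima; it is absorbed because both maxima are at least 1.\<close>

definition csubspace :: "('a \<Rightarrow> complex) set \<Rightarrow> bool" where
  "csubspace V \<longleftrightarrow> (\<lambda>_. 0) \<in> V \<and> (\<forall>x\<in>V. \<forall>y\<in>V. (\<lambda>a. x a + y a) \<in> V) \<and> (\<forall>c. \<forall>x\<in>V. (\<lambda>a. c * x a) \<in> V)"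

text \<open>Linearity relative to a subspace serves \<open>fvec S\<close> and the bounded functions
  \<open>linf K\<close> alike.\<close>

definition lin_on :: "('a \<Rightarrow> complex) set \<Rightarrow> (('a \<Rightarrow> complex) \<Rightarrow> ('b \<Rightarrow> complex)) \<Rightarrow> bool" where
  "lin_on V L \<longleftrightarrow> (\<forall>x\<in>V. \<forall>y\<in>V. L (\<lambda>a. x a + y a) = (\<lambda>b. L x b + L y b)) \<and>
     (\<forall>c. \<forall>x\<in>V. L (\<lambda>a. c * x a) = (\<lambda>b. c * L x b))"

lemma csubspace_zero: "csubspace V \<Longrightarrow> (\<lambda>_. 0) \<in> V"
  and csubspace_add: "csubspace V \<Longrightarrow> x \<in> V \<Longrightarrow> y \<in> V \<Longrightarrow> (\<lambda>a. x a + y a) \<in> V"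
  and csubspace_smult: "csubspace V \<Longrightarrow> x \<in> V \<Longrightarrow> (\<lambda>a. c * x a) \<in> V"
  by (simp_all add: csubspace_def)

lemma lin_on_add: "lin_on V L \<Longrightarrow> x \<in> V \<Longrightarrow> y \<in> V \<Longrightarrow> L (\<lambda>a. x a + y a) = (\<lambda>b. L x b + L y b)"
  and lin_on_smult: "lin_on V L \<Longrightarrow> x \<in> V \<Longrightarrow> L (\<lambda>a. c * x a) = (\<lambda>b. c * L x b)"
  by (simp_all add: lin_on_def)

lemma lin_on_diff:
  assumes "csubspace V" "lin_on V L" "x \<in> V" "y \<in> V"
  shows "(\<lambda>a. x a - y a) \<in> V" "L (\<lambda>a. x a - y a) = (\<lambda>b. L x b - L y b)"
proof -
  have y: "(\<lambda>a. (- 1) * y a) \<in> V" by (rule csubspace_smult[OF assms(1,4)])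
  show "(\<lambda>a. x a - y a) \<in> V" using csubspace_add[OF assms(1,3) y] by simp
  have "L (\<lambda>a. x a + (- 1) * y a) = (\<lambda>b. L x b + L (\<lambda>a. (- 1) * y a) b)"
    by (rule lin_on_add[OF assms(2,3) y])
  also have "L (\<lambda>a. (- 1) * y a) = (\<lambda>b. (- 1) * L y b)" by (rule lin_on_smult[OF assms(2,4)])
  finally show "L (\<lambda>a. x a - y a) = (\<lambda>b. L x b - L y b)" by simp
qed

lemma csubspace_sum:
  assumes "csubspace V" "finite I" "\<And>i. i \<in> I \<Longrightarrow> f i \<in> V"
  shows "(\<lambda>a. \<Sum>i\<in>I. c i * f i a) \<in> V"
  using assms(2,3)
proof (induction I rule: finite_induct)
  case empty
  then show ?case using assms(1) by (simp add: csubspace_def)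
next
  case (insert i I)
  then have "(\<lambda>a. c i * f i a) \<in> V" "(\<lambda>a. \<Sum>i\<in>I. c i * f i a) \<in> V"
    using assms(1) by (auto simp: csubspace_def)
  then have "(\<lambda>a. c i * f i a + (\<Sum>i\<in>I. c i * f i a)) \<in> V"
    by (rule csubspace_add[OF assms(1)])
  then show ?case using insert by simp
qed

lemma lin_on_zero:
  assumes "csubspace V" "lin_on V L"
  shows "L (\<lambda>_. 0) = (\<lambda>_. 0)"
proof -
  have "L (\<lambda>a. 0 * 0) = (\<lambda>b. 0 * L (\<lambda>_. 0) b)"
    by (rule lin_on_smult[OF assms(2) csubspace_zero[OF assms(1)]])
  then show ?thesis by simp
qed

lemma lin_on_sum:
  assumes "csubspace V" "lin_on V L" "finite I" "\<And>i. i \<in> I \<Longrightarrow> f i \<in> V"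
  shows "L (\<lambda>a. \<Sum>i\<in>I. c i * f i a) = (\<lambda>b. \<Sum>i\<in>I. c i * L (f i) b)"
  using assms(3,4)
proof (induction I rule: finite_induct)
  case empty
  then show ?case using lin_on_zero[OF assms(1,2)] by simp
next
  case (insert i I)
  have a: "(\<lambda>a. c i * f i a) \<in> V" using assms(1) insert by (auto simp: csubspace_def)
  have b: "(\<lambda>a. \<Sum>i\<in>I. c i * f i a) \<in> V" using csubspace_sum[OF assms(1), of I f c] insert by auto
  have "L (\<lambda>a. c i * f i a + (\<Sum>i\<in>I. c i * f i a)) = (\<lambda>b. L (\<lambda>a. c i * f i a) b + L (\<lambda>a. \<Sum>i\<in>I. c i * f i a) b)"
    by (rule lin_on_add[OF assms(2) a b])
  also have "L (\<lambda>a. c i * f i a) = (\<lambda>b. c i * L (f i) b)"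
    by (rule lin_on_smult[OF assms(2)]) (use insert in auto)
  also have "L (\<lambda>a. \<Sum>i\<in>I. c i * f i a) = (\<lambda>b. \<Sum>i\<in>I. c i * L (f i) b)"
    using insert by auto
  finally show ?case using insert by simp
qed

lemma csubspace_fvec: "csubspace (fvec S)"
  by (auto simp: csubspace_def fvec_def)

lemma fvec_zero [simp, intro]: "(\<lambda>_. 0) \<in> fvec S"
  and fvec_add [intro]: "x \<in> fvec S \<Longrightarrow> y \<in> fvec S \<Longrightarrow> (\<lambda>a. x a + y a) \<in> fvec S"
  and fvec_smult [intro]: "x \<in> fvec S \<Longrightarrow> (\<lambda>a. c * x a) \<in> fvec S"
  and fvec_mono: "S \<subseteq> S' \<Longrightarrow> x \<in> fvec S \<Longrightarrow> x \<in> fvec S'"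
  by (auto simp: fvec_def)

lemma fvec_sum [intro]: "(\<And>i. i \<in> I \<Longrightarrow> f i \<in> fvec S) \<Longrightarrow> (\<lambda>a. \<Sum>i\<in>I. f i a) \<in> fvec S"
  by (auto simp: fvec_def)

lemma is_op_lin_on: "is_op S T u \<longleftrightarrow> (\<forall>x\<in>fvec S. u x \<in> fvec T) \<and> lin_on (fvec S) u"
  by (auto simp: is_op_def lin_on_def)

lemma is_op_fvec: "is_op S T u \<Longrightarrow> x \<in> fvec S \<Longrightarrow> u x \<in> fvec T"
  by (simp add: is_op_def)

text \<open>Scalars are viewed as functions on \<open>unit\<close>, so that facts about
  \<open>lin_on\<close> carry over to functionals.\<close>

lemma lin_functional_lin_on: "lin_functional S \<phi> \<longleftrightarrow> lin_on (fvec S) (\<lambda>x (_::unit). \<phi> x)"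
  by (auto simp: lin_functional_def lin_on_def fun_eq_iff)

lemma is_op_sum:
  assumes "is_op S T u" "finite I" "\<And>i. i \<in> I \<Longrightarrow> f i \<in> fvec S"
  shows "u (\<lambda>a. \<Sum>i\<in>I. c i * f i a) = (\<lambda>b. \<Sum>i\<in>I. c i * u (f i) b)"
  using lin_on_sum[OF csubspace_fvec, of S u I f c] assms by (auto simp: is_op_lin_on)

lemma lin_functional_sum:
  assumes "lin_functional S \<phi>" "finite I" "\<And>i. i \<in> I \<Longrightarrow> f i \<in> fvec S"
  shows "\<phi> (\<lambda>a. \<Sum>i\<in>I. c i * f i a) = (\<Sum>i\<in>I. c i * \<phi> (f i))"
proof -
  have "(\<lambda>_::unit. \<phi> (\<lambda>a. \<Sum>i\<in>I. c i * f i a)) = (\<lambda>_. \<Sum>i\<in>I. c i * \<phi> (f i))"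
    by (rule lin_on_sum[OF csubspace_fvec, of S "\<lambda>x (_::unit). \<phi> x"])
      (use assms in \<open>auto simp: lin_functional_lin_on\<close>)
  then show ?thesis by (simp add: fun_eq_iff)
qed

definition unitv :: "'a \<Rightarrow> 'a \<Rightarrow> complex" where
  "unitv \<alpha> = (\<lambda>a. if a = \<alpha> then 1 else 0)"

lemma unitv_fvec [simp, intro]: "\<alpha> \<in> S \<Longrightarrow> unitv \<alpha> \<in> fvec S"
  by (auto simp: unitv_def fvec_def)

lemma fvec_expand:
  assumes "finite S" "x \<in> fvec S"
  shows "(\<lambda>a. \<Sum>\<alpha>\<in>S. x \<alpha> * unitv \<alpha> a) = x"
proof
  fix a
  have "(\<Sum>\<alpha>\<in>S. x \<alpha> * unitv \<alpha> a) = (\<Sum>\<alpha>\<in>S. if a = \<alpha> then x \<alpha> else 0)"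
    by (intro sum.cong) (auto simp: unitv_def)
  then show "(\<Sum>\<alpha>\<in>S. x \<alpha> * unitv \<alpha> a) = x a"
    using assms by (auto simp: fvec_def)
qed

text \<open>The coordinate bound \<open>coord\<close> makes \<open>p\<close> definite and spares an appeal to the equivalence of norms.\<close>

locale coord_normed =
  fixes S :: "'a set" and p :: "('a \<Rightarrow> complex) \<Rightarrow> real"
  assumes fin: "finite S"
    and nonneg: "x \<in> fvec S \<Longrightarrow> 0 \<le> p x"
    and hom: "x \<in> fvec S \<Longrightarrow> p (\<lambda>a. c * x a) = cmod c * p x"
    and tri: "x \<in> fvec S \<Longrightarrow> y \<in> fvec S \<Longrightarrow> p (\<lambda>a. x a + y a) \<le> p x + p y"
    and coord: "\<exists>B. \<forall>x\<in>fvec S. \<forall>a\<in>S. cmod (x a) \<le> B * p x"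
begin

lemma zero: "p (\<lambda>_. 0) = 0"
  using hom[of "\<lambda>_. 0" 0] by simp

lemma coordE:
  obtains B where "B > 0" "\<And>x a. x \<in> fvec S \<Longrightarrow> cmod (x a) \<le> B * p x"
proof -
  obtain B where B: "\<forall>x\<in>fvec S. \<forall>a\<in>S. cmod (x a) \<le> B * p x" using coord by blast
  have "cmod (x a) \<le> max B 1 * p x" if "x \<in> fvec S" for x a
  proof (cases "a \<in> S")
    case True
    then have "cmod (x a) \<le> B * p x" using B that by blast
    also have "\<dots> \<le> max B 1 * p x" using nonneg[OF that] by (intro mult_right_mono) auto
    finally show ?thesis .
  next
    case False
    then show ?thesis using that nonneg[OF that] by (auto simp: fvec_def)
  qed
  then show ?thesis using that[of "max B 1"] by auto
qed

lemma eq_zero: "x \<in> fvec S \<Longrightarrow> p x = 0 \<Longrightarrow> x = (\<lambda>_. 0)"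
  using coordE by (metis ext mult_zero_right norm_le_zero_iff)

lemma norm_sum:
  assumes "finite I" "\<And>i. i \<in> I \<Longrightarrow> f i \<in> fvec S"
  shows "p (\<lambda>a. \<Sum>i\<in>I. c i * f i a) \<le> (\<Sum>i\<in>I. cmod (c i) * p (f i))"
  using assms
proof (induction I rule: finite_induct)
  case empty
  then show ?case by (simp add: zero)
next
  case (insert i I)
  have "p (\<lambda>a. c i * f i a + (\<Sum>i\<in>I. c i * f i a)) \<le> p (\<lambda>a. c i * f i a) + p (\<lambda>a. \<Sum>i\<in>I. c i * f i a)"
    using insert by (intro tri) (auto intro!: csubspace_sum[OF csubspace_fvec])
  also have "\<dots> \<le> cmod (c i) * p (f i) + (\<Sum>i\<in>I. cmod (c i) * p (f i))"
    using insert hom by auto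
  finally show ?case using insert by simp
qed

lemma lin_bounded:
  assumes "coord_normed T q" "is_op S T u"
  obtains B where "B \<ge> 0" "\<And>x. x \<in> fvec S \<Longrightarrow> q (u x) \<le> B * p x"
proof -
  interpret T: coord_normed T q by fact
  obtain B where B: "B > 0" "\<And>x a. x \<in> fvec S \<Longrightarrow> cmod (x a) \<le> B * p x" using coordE by blast
  define D where "D = (\<Sum>\<alpha>\<in>S. B * q (u (unitv \<alpha>)))"
  have q: "q (u (unitv \<alpha>)) \<ge> 0" if "\<alpha> \<in> S" for \<alpha>
    using that assms(2) T.nonneg is_op_fvec[OF assms(2)] by blast
  have "q (u x) \<le> D * p x" if x: "x \<in> fvec S" for x
  proof -
    have "u x = (\<lambda>b. \<Sum>\<alpha>\<in>S. x \<alpha> * u (unitv \<alpha>) b)"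
      using is_op_sum[OF assms(2) fin, of unitv x] fvec_expand[OF fin x] by simp
    then have "q (u x) \<le> (\<Sum>\<alpha>\<in>S. cmod (x \<alpha>) * q (u (unitv \<alpha>)))"
      using T.norm_sum[OF fin, of "\<lambda>\<alpha>. u (unitv \<alpha>)" x] is_op_fvec[OF assms(2)] by auto
    also have "\<dots> \<le> (\<Sum>\<alpha>\<in>S. (B * p x) * q (u (unitv \<alpha>)))"
      using B x q by (intro sum_mono mult_right_mono) auto
    also have "\<dots> = D * p x" by (simp add: D_def sum_distrib_left sum_distrib_right mult_ac)
    finally show ?thesis .
  qed
  moreover have "D \<ge> 0" unfolding D_def using q B by (intro sum_nonneg) auto
  ultimately show ?thesis using that by blast
qed

lemma opnorm_bdd:
  assumes "coord_normed T q" "is_op S T u"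
  shows "bdd_above {q (u x) | x. x \<in> fvec S \<and> p x \<le> 1}"
proof -
  obtain B where B: "B \<ge> 0" "\<And>x. x \<in> fvec S \<Longrightarrow> q (u x) \<le> B * p x"
    using lin_bounded[OF assms] by blast
  have "q (u x) \<le> B" if "x \<in> fvec S" "p x \<le> 1" for x
    using B(2)[OF that(1)] mult_left_mono[OF that(2) B(1)] by simp
  then show ?thesis by (auto intro!: bdd_aboveI[of _ B])
qed

lemma opnorm_nonneg:
  assumes "coord_normed T q" "is_op S T u"
  shows "0 \<le> opnorm S p T q u"
proof -
  interpret T: coord_normed T q by fact
  have "0 \<le> q (u (\<lambda>_. 0))" using T.nonneg is_op_fvec[OF assms(2)] by blast
  also have "\<dots> \<le> opnorm S p T q u"
    unfolding opnorm_def by (rule cSup_upper[OF _ opnorm_bdd[OF assms]]) (auto simp: zero intro!: exI[of _ "\<lambda>_. 0"])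
  finally show ?thesis .
qed

lemma opnorm_ge:
  assumes "coord_normed T q" "is_op S T u" "x \<in> fvec S"
  shows "q (u x) \<le> opnorm S p T q u * p x"
proof (cases "p x = 0")
  case True
  interpret T: coord_normed T q by fact
  have "u x = (\<lambda>_. 0)" using eq_zero[OF assms(3) True] lin_on_zero[OF csubspace_fvec] assms(2)
    by (auto simp: is_op_lin_on)
  then show ?thesis using True T.zero by simp
next
  case False
  interpret T: coord_normed T q by fact
  have pos: "p x > 0" using False nonneg[OF assms(3)] by simp
  define y where "y = (\<lambda>a. complex_of_real (1 / p x) * x a)"
  have y: "y \<in> fvec S" "p y = 1" using assms(3) pos hom[OF assms(3), of "complex_of_real (1 / p x)"]
    by (auto simp: y_def simp flip: of_real_divide)
  have "u y = (\<lambda>b. complex_of_real (1 / p x) * u x b)"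
    unfolding y_def by (rule lin_on_smult) (use assms(2,3) in \<open>auto simp: is_op_lin_on\<close>)
  then have "q (u y) = (1 / p x) * q (u x)"
    using T.hom[OF is_op_fvec[OF assms(2,3)], of "complex_of_real (1 / p x)"] pos
    by (simp del: of_real_divide)
  moreover have "q (u y) \<le> opnorm S p T q u"
    unfolding opnorm_def by (rule cSup_upper[OF _ opnorm_bdd[OF assms(1,2)]]) (use y in auto)
  ultimately have "(1 / p x) * q (u x) \<le> opnorm S p T q u" by simp
  then show ?thesis using pos by (simp add: pos_divide_le_eq)
qed

lemma opnorm_le:
  assumes "0 \<le> D" "\<And>x. x \<in> fvec S \<Longrightarrow> q (u x) \<le> D * p x"
  shows "opnorm S p T q u \<le> D"
  unfolding opnorm_def
proof (rule cSup_least)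
  show "{q (u x) | x. x \<in> fvec S \<and> p x \<le> 1} \<noteq> {}"
    using zero fvec_zero[of S] by (metis (mono_tags, lifting) empty_Collect_eq zero_le_one)
  fix y assume "y \<in> {q (u x) | x. x \<in> fvec S \<and> p x \<le> 1}"
  then obtain x where x: "y = q (u x)" "x \<in> fvec S" "p x \<le> 1" by blast
  have "D * p x \<le> D" using mult_left_mono[OF x(3) assms(1)] by simp
  then show "y \<le> D" using assms(2)[OF x(2)] x(1) by linarith
qed

lemma opnorm_isometry_ge_1:
  assumes "coord_normed T q" "is_op S T u" "x \<in> fvec S" "x \<noteq> (\<lambda>_. 0)" "q (u x) = p x"
  shows "1 \<le> opnorm S p T q u"
proof -
  have "p x > 0" using nonneg[OF assms(3)] eq_zero assms(3,4) by fastforce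
  then show ?thesis using opnorm_ge[OF assms(1,2,3)] assms(5) by simp
qed

end

section \<open>The spaces l_1^n and l_2^n\<close>

lemma coord_normed_l1: "coord_normed {..<n} (l1norm n)"
proof
  show "\<exists>B. \<forall>x\<in>fvec {..<n}. \<forall>a\<in>{..<n}. cmod (x a) \<le> B * l1norm n x"
  proof (intro exI[of _ 1] ballI)
    fix x :: "nat \<Rightarrow> complex" and a assume "a \<in> {..<n}"
    then have "cmod (x a) \<le> (\<Sum>i<n. cmod (x i))" by (intro member_le_sum) auto
    then show "cmod (x a) \<le> 1 * l1norm n x" by (simp add: l1norm_def)
  qed
qed (auto simp: l1norm_def sum_nonneg norm_mult sum_distrib_left norm_triangle_ineq
        simp flip: sum.distrib intro!: sum_mono)

lemma l2norm_L2_set: "l2norm n x = L2_set (\<lambda>i. cmod (x i)) {..<n}"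
  by (simp add: l2norm_def L2_set_def)

lemma coord_normed_l2: "coord_normed {..<n} (l2norm n)"
proof
  show "\<exists>B. \<forall>x\<in>fvec {..<n}. \<forall>a\<in>{..<n}. cmod (x a) \<le> B * l2norm n x"
    by (intro exI[of _ 1]) (auto simp: l2norm_L2_set intro!: member_le_L2_set)
  show "l2norm n (\<lambda>a. c * x a) = cmod c * l2norm n x" for x c
    by (simp add: l2norm_L2_set norm_mult L2_set_right_distrib)
  show "l2norm n (\<lambda>a. x a + y a) \<le> l2norm n x + l2norm n y" for x y
  proof -
    have "l2norm n (\<lambda>a. x a + y a) \<le> L2_set (\<lambda>i. cmod (x i) + cmod (y i)) {..<n}"
      unfolding l2norm_L2_set by (intro L2_set_mono) (auto simp: norm_triangle_ineq)
    then show ?thesis using L2_set_triangle_ineq unfolding l2norm_L2_set by (rule order_trans)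
  qed
qed (auto simp: l2norm_L2_set)

subsection \<open>Factorization through \<open>\<ell>\<^sub>1\<close>\<close>

text \<open>The condition that \<open>gamma1\<close> is at most \<open>D\<close>, in coordinates:
  the map into l_1 has the coordinates \<open>f i\<close> scaled by \<open>q (y i)\<close>, and the
  map out of l_1 sends the unit vectors to the normalized \<open>y i\<close>. In this form
  factorizations of several operators can be added term by term.\<close>

definition l1_factor :: "'a set \<Rightarrow> (('a \<Rightarrow> complex) \<Rightarrow> real) \<Rightarrow> 'b set \<Rightarrow> (('b \<Rightarrow> complex) \<Rightarrow> real)
    \<Rightarrow> (('a \<Rightarrow> complex) \<Rightarrow> ('b \<Rightarrow> complex)) \<Rightarrow> real \<Rightarrow> bool" where
  "l1_factor S p T q u D \<longleftrightarrow> (\<exists>(n::nat) f y.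
     (\<forall>i<n. lin_functional S (f i) \<and> y i \<in> fvec T) \<and>
     (\<forall>x\<in>fvec S. u x = (\<lambda>b. \<Sum>i<n. f i x * y i b) \<and> (\<Sum>i<n. cmod (f i x) * q (y i)) \<le> D * p x))"

lemma l1_factorI:
  assumes "finite I"
    and "\<And>i. i \<in> I \<Longrightarrow> lin_functional S (f i)" "\<And>i. i \<in> I \<Longrightarrow> y i \<in> fvec T"
    and "\<And>x. x \<in> fvec S \<Longrightarrow> u x = (\<lambda>b. \<Sum>i\<in>I. f i x * y i b)"
    and "\<And>x. x \<in> fvec S \<Longrightarrow> (\<Sum>i\<in>I. cmod (f i x) * q (y i)) \<le> D * p x"
  shows "l1_factor S p T q u D"
proof -
  obtain h where h: "bij_betw h {..<card I} I"
    using ex_bij_betw_nat_finite[OF assms(1)] by (auto simp: atLeast0LessThan)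
  have hI: "h i \<in> I" if "i < card I" for i using h that by (auto simp: bij_betw_def)
  have c: "(\<Sum>i<card I. f (h i) x * y (h i) b) = (\<Sum>i\<in>I. f i x * y i b)" for x b
    by (rule sum.reindex_bij_betw[OF h])
  have r: "(\<Sum>i<card I. cmod (f (h i) x) * q (y (h i))) = (\<Sum>i\<in>I. cmod (f i x) * q (y i))" for x
    by (rule sum.reindex_bij_betw[OF h])
  show ?thesis unfolding l1_factor_def
  proof (intro exI[of _ "card I"] exI[of _ "\<lambda>i. f (h i)"] exI[of _ "\<lambda>i. y (h i)"] conjI allI impI ballI)
    fix x assume "x \<in> fvec S"
    then show "u x = (\<lambda>b. \<Sum>i<card I. f (h i) x * y (h i) b)"
      "(\<Sum>i<card I. cmod (f (h i) x) * q (y (h i))) \<le> D * p x"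
      unfolding c r using assms(4,5) by blast+
  qed (use assms(2,3) hI in blast)+
qed

lemma l1_factor_mono:
  assumes "coord_normed S p" "l1_factor S p T q u D" "D \<le> D'"
  shows "l1_factor S p T q u D'"
proof -
  interpret coord_normed S p by fact
  obtain n :: nat and f y where "(\<forall>i<n. lin_functional S (f i) \<and> y i \<in> fvec T) \<and>
     (\<forall>x\<in>fvec S. u x = (\<lambda>b. \<Sum>i<n. f i x * y i b) \<and> (\<Sum>i<n. cmod (f i x) * q (y i)) \<le> D * p x)"
    using assms(2) unfolding l1_factor_def by (elim exE)
  then have *: "\<And>i. i < n \<Longrightarrow> lin_functional S (f i)" "\<And>i. i < n \<Longrightarrow> y i \<in> fvec T"
    "\<And>x. x \<in> fvec S \<Longrightarrow> u x = (\<lambda>b. \<Sum>i<n. f i x * y i b)"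
    "\<And>x. x \<in> fvec S \<Longrightarrow> (\<Sum>i<n. cmod (f i x) * q (y i)) \<le> D * p x"
    by blast+
  show ?thesis
  proof (rule l1_factorI[of "{..<n}" _ f y])
    fix x assume x: "x \<in> fvec S"
    have "D * p x \<le> D' * p x" using assms(3) nonneg[OF x] by (rule mult_right_mono)
    then show "(\<Sum>i<n. cmod (f i x) * q (y i)) \<le> D' * p x" using *(4)[OF x] by linarith
  qed (simp_all add: *(1,2) *(3)[symmetric])
qed

lemma l1_factor_cong:
  assumes "l1_factor S p T q u D" "\<And>x. x \<in> fvec S \<Longrightarrow> u x = u' x"
  shows "l1_factor S p T q u' D"
  using assms(1) unfolding l1_factor_def by (simp add: assms(2) cong: conj_cong)

text \<open>The l_1-sum of two spaces l_1^n is again such a space: the two lists of rank-one terms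
  are concatenated, and the bounds add up.\<close>

lemma l1_factor_add:
  assumes "l1_factor S p T q u D" "l1_factor S p T q u' D'"
  shows "l1_factor S p T q (\<lambda>x b. u x b + u' x b) (D + D')"
proof -
  obtain n :: nat and f y where "(\<forall>i<n. lin_functional S (f i) \<and> y i \<in> fvec T) \<and>
     (\<forall>x\<in>fvec S. u x = (\<lambda>b. \<Sum>i<n. f i x * y i b) \<and> (\<Sum>i<n. cmod (f i x) * q (y i)) \<le> D * p x)"
    using assms(1) unfolding l1_factor_def by (elim exE)
  then have *: "\<And>i. i < n \<Longrightarrow> lin_functional S (f i)" "\<And>i. i < n \<Longrightarrow> y i \<in> fvec T"
    "\<And>x. x \<in> fvec S \<Longrightarrow> u x = (\<lambda>b. \<Sum>i<n. f i x * y i b)"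
    "\<And>x. x \<in> fvec S \<Longrightarrow> (\<Sum>i<n. cmod (f i x) * q (y i)) \<le> D * p x"
    by blast+
  obtain n' :: nat and f' y' where "(\<forall>i<n'. lin_functional S (f' i) \<and> y' i \<in> fvec T) \<and>
     (\<forall>x\<in>fvec S. u' x = (\<lambda>b. \<Sum>i<n'. f' i x * y' i b) \<and> (\<Sum>i<n'. cmod (f' i x) * q (y' i)) \<le> D' * p x)"
    using assms(2) unfolding l1_factor_def by (elim exE)
  then have **: "\<And>i. i < n' \<Longrightarrow> lin_functional S (f' i)" "\<And>i. i < n' \<Longrightarrow> y' i \<in> fvec T"
    "\<And>x. x \<in> fvec S \<Longrightarrow> u' x = (\<lambda>b. \<Sum>i<n'. f' i x * y' i b)"
    "\<And>x. x \<in> fvec S \<Longrightarrow> (\<Sum>i<n'. cmod (f' i x) * q (y' i)) \<le> D' * p x"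
    by blast+
  show ?thesis
  proof (rule l1_factorI[of "{..<n} <+> {..<n'}" _ "case_sum f f'" "case_sum y y'"])
    fix x assume x: "x \<in> fvec S"
    show "(\<lambda>b. u x b + u' x b) = (\<lambda>b. \<Sum>i\<in>{..<n} <+> {..<n'}. case_sum f f' i x * case_sum y y' i b)"
      by (simp add: sum.Plus *(3)[OF x] **(3)[OF x] comp_def)
    show "(\<Sum>i\<in>{..<n} <+> {..<n'}. cmod (case_sum f f' i x) * q (case_sum y y' i)) \<le> (D + D') * p x"
      using *(4)[OF x] **(4)[OF x] by (simp add: sum.Plus comp_def distrib_right)
  next
    fix i assume "i \<in> {..<n} <+> {..<n'}"
    then show "lin_functional S (case_sum f f' i)" "case_sum y y' i \<in> fvec T"
      using *(1,2) **(1,2) by auto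
  qed simp
qed

lemma l1_factor_sum:
  assumes "finite A" "\<And>k. k \<in> A \<Longrightarrow> l1_factor S p T q (u k) (D k)"
  shows "l1_factor S p T q (\<lambda>x b. \<Sum>k\<in>A. u k x b) (\<Sum>k\<in>A. D k)"
  using assms
proof (induction A rule: finite_induct)
  case empty
  show ?case by (rule l1_factorI[of "{} :: nat set"]) auto
next
  case (insert k A)
  then have "l1_factor S p T q (\<lambda>x b. u k x b + (\<Sum>k\<in>A. u k x b)) (D k + (\<Sum>k\<in>A. D k))"
    by (intro l1_factor_add) auto
  then show ?case using insert(1,2) by simp
qed

lemma l1_factor_compose:
  assumes "coord_normed S p" "l1_factor S p T q u D" "D \<ge> 0" "is_op R S v"
    "\<And>x. x \<in> fvec R \<Longrightarrow> p (v x) \<le> r x"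
  shows "l1_factor R r T q (\<lambda>x. u (v x)) D"
proof -
  obtain n :: nat and f y where "(\<forall>i<n. lin_functional S (f i) \<and> y i \<in> fvec T) \<and>
     (\<forall>x\<in>fvec S. u x = (\<lambda>b. \<Sum>i<n. f i x * y i b) \<and> (\<Sum>i<n. cmod (f i x) * q (y i)) \<le> D * p x)"
    using assms(2) unfolding l1_factor_def by (elim exE)
  then have *: "\<And>i. i < n \<Longrightarrow> lin_functional S (f i)" "\<And>i. i < n \<Longrightarrow> y i \<in> fvec T"
    "\<And>x. x \<in> fvec S \<Longrightarrow> u x = (\<lambda>b. \<Sum>i<n. f i x * y i b)"
    "\<And>x. x \<in> fvec S \<Longrightarrow> (\<Sum>i<n. cmod (f i x) * q (y i)) \<le> D * p x"
    by blast+
  have v: "v x \<in> fvec S" if "x \<in> fvec R" for x using assms(4) that by (rule is_op_fvec)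
  show ?thesis
  proof (rule l1_factorI[of "{..<n}" _ "\<lambda>i x. f i (v x)" y])
    fix i assume "i \<in> {..<n}"
    then show "lin_functional R (\<lambda>x. f i (v x))"
      using *(1)[of i] assms(4) v unfolding lin_functional_def is_op_def by auto
  next
    fix x assume x: "x \<in> fvec R"
    have "(\<Sum>i<n. cmod (f i (v x)) * q (y i)) \<le> D * p (v x)" using *(4) v[OF x] by blast
    also have "\<dots> \<le> D * r x" using assms(5)[OF x] assms(3) by (intro mult_left_mono)
    finally show "(\<Sum>i<n. cmod (f i (v x)) * q (y i)) \<le> D * r x" .
  qed (simp_all add: *(2) *(3)[OF v, symmetric])
qed

lemma gamma1_le:
  assumes "coord_normed S p" "coord_normed T q" "l1_factor S p T q u D" "D \<ge> 0"
  shows "gamma1 S p T q u \<le> D"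
proof -
  interpret S: coord_normed S p by fact
  interpret T: coord_normed T q by fact
  obtain n :: nat and f y where "(\<forall>i<n. lin_functional S (f i) \<and> y i \<in> fvec T) \<and>
     (\<forall>x\<in>fvec S. u x = (\<lambda>b. \<Sum>i<n. f i x * y i b) \<and> (\<Sum>i<n. cmod (f i x) * q (y i)) \<le> D * p x)"
    using assms(3) unfolding l1_factor_def by (elim exE)
  then have *: "\<And>i. i < n \<Longrightarrow> lin_functional S (f i)" "\<And>i. i < n \<Longrightarrow> y i \<in> fvec T"
    "\<And>x. x \<in> fvec S \<Longrightarrow> u x = (\<lambda>b. \<Sum>i<n. f i x * y i b)"
    "\<And>x. x \<in> fvec S \<Longrightarrow> (\<Sum>i<n. cmod (f i x) * q (y i)) \<le> D * p x"
    by blast+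
  interpret L: coord_normed "{..<n}" "l1norm n" by (rule coord_normed_l1)
  \<comment> \<open>The weight \<open>q (y i)\<close> is carried by \<open>v\<close>, so that
    \<open>w\<close> sends unit vectors to vectors of norm at most 1. If \<open>q (y i) = 0\<close>,
    then \<open>y i\<close> is zero and the value 0 of the quotient is the right one.\<close>
  define v where "v = (\<lambda>x i. if i < n then f i x * complex_of_real (q (y i)) else 0)"
  define w where "w = (\<lambda>(g::nat \<Rightarrow> complex) b. \<Sum>i<n. g i * (y i b / complex_of_real (q (y i))))"
  have v: "is_op S {..<n} v"
    using *(1) unfolding is_op_def v_def fvec_def[of "{..<n}"]
    by (auto simp: fun_eq_iff lin_functional_def algebra_simps)
  have w: "is_op {..<n} T w"
    using *(2) unfolding is_op_def w_def
    by (auto simp: fun_eq_iff fvec_def algebra_simps add_divide_distrib sum.distrib sum_distrib_left intro!: sum.neutral)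
  have qy: "q (y i) \<ge> 0" if "i < n" for i using T.nonneg *(2) that by blast
  have vn: "opnorm S p {..<n} (l1norm n) v \<le> D"
    using assms(4) *(4) qy by (intro S.opnorm_le) (auto simp: v_def l1norm_def norm_mult)
  have wn: "opnorm {..<n} (l1norm n) T q w \<le> 1"
  proof (rule L.opnorm_le)
    fix x :: "nat \<Rightarrow> complex" assume "x \<in> fvec {..<n}"
    have "q (w x) \<le> (\<Sum>i<n. cmod (x i / complex_of_real (q (y i))) * q (y i))"
      using T.norm_sum[of "{..<n}" y "\<lambda>i. x i / complex_of_real (q (y i))"] *(2) by (simp add: w_def)
    also have "\<dots> \<le> (\<Sum>i<n. cmod (x i))"
      using qy by (intro sum_mono) (auto simp: norm_divide)
    finally show "q (w x) \<le> 1 * l1norm n x" by (simp add: l1norm_def)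
  qed simp
  have wv: "w (v x) = u x" if "x \<in> fvec S" for x
  proof -
    have "v x i * (y i b / complex_of_real (q (y i))) = f i x * y i b" if "i < n" for i b
      using T.eq_zero[OF *(2)[OF that]] by (cases "q (y i) = 0") (auto simp: v_def that)
    then show ?thesis using *(3)[OF that] by (auto simp: w_def)
  qed
  have "gamma1 S p T q u \<le> opnorm S p {..<n} (l1norm n) v * opnorm {..<n} (l1norm n) T q w"
    unfolding gamma1_def
  proof (rule cInf_lower)
    show "bdd_below {opnorm S p {..<N} (l1norm N) v * opnorm {..<N} (l1norm N) T q w |N v w.
      is_op S {..<N} v \<and> is_op {..<N} T w \<and> (\<forall>x\<in>fvec S. w (v x) = u x)}"
      using S.opnorm_nonneg[OF coord_normed_l1] coord_normed.opnorm_nonneg[OF coord_normed_l1 assms(2)]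
      by (intro bdd_belowI[of _ 0]) auto
  qed (use v w wv in blast)
  also have "\<dots> \<le> D * 1"
    using vn wn assms(4) S.opnorm_nonneg[OF coord_normed_l1 v] L.opnorm_nonneg[OF assms(2) w]
    by (intro mult_mono) auto
  finally show ?thesis by simp
qed

subsection \<open>Absolutely summing operators\<close>

text \<open>The admissible constants in the infimum \<open>pi1\<close>; arguing with an arbitrary
  one leaves open whether the infimum is attained.\<close>

definition summing :: "'a set \<Rightarrow> (('a \<Rightarrow> complex) \<Rightarrow> real) \<Rightarrow> 'b set \<Rightarrow> (('b \<Rightarrow> complex) \<Rightarrow> real)
    \<Rightarrow> (('a \<Rightarrow> complex) \<Rightarrow> ('b \<Rightarrow> complex)) \<Rightarrow> real \<Rightarrow> bool" where
  "summing S p T q u C \<longleftrightarrow> 0 \<le> C \<and>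
      (\<forall>(k::nat) xs. (\<forall>j<k. xs j \<in> fvec S) \<longrightarrow>
         (\<Sum>j<k. q (u (xs j))) \<le> C * Sup {\<Sum>j<k. cmod (\<phi> (xs j)) | \<phi>. \<phi> \<in> dual_ball S p})"

lemma pi1_summing: "pi1 S p T q u = Inf {C. summing S p T q u C}"
  by (simp add: pi1_def summing_def)

lemma dual_ballD: "\<phi> \<in> dual_ball S p \<Longrightarrow> lin_functional S \<phi>"
  "\<phi> \<in> dual_ball S p \<Longrightarrow> x \<in> fvec S \<Longrightarrow> cmod (\<phi> x) \<le> p x"
  by (auto simp: dual_ball_def)

lemma cnj_sgn_mult: "cnj (sgn z) * z = complex_of_real (cmod z)"
proof (cases "z = 0")
  case False
  have "cnj z * z = complex_of_real (cmod z) * complex_of_real (cmod z)"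
    by (metis complex_norm_square mult.commute power2_eq_square of_real_power)
  then show ?thesis using False by (simp add: sgn_eq)
qed simp

context coord_normed
begin

lemma dual_ball_zero: "(\<lambda>_. 0) \<in> dual_ball S p"
  using nonneg by (auto simp: dual_ball_def lin_functional_def)

lemma dual_ball_bdd:
  assumes "\<And>j. j < k \<Longrightarrow> xs j \<in> fvec S"
  shows "bdd_above {\<Sum>j<(k::nat). cmod (\<phi> (xs j)) | \<phi>. \<phi> \<in> dual_ball S p}"
proof (rule bdd_aboveI[of _ "\<Sum>j<k. p (xs j)"])
  fix y assume "y \<in> {\<Sum>j<k. cmod (\<phi> (xs j)) | \<phi>. \<phi> \<in> dual_ball S p}"
  then obtain \<phi> where \<phi>: "\<phi> \<in> dual_ball S p" "y = (\<Sum>j<k. cmod (\<phi> (xs j)))" by blast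
  show "y \<le> (\<Sum>j<k. p (xs j))"
    unfolding \<phi>(2) using assms by (intro sum_mono dual_ballD(2)[OF \<phi>(1)]) auto
qed

lemma summing_le:
  assumes "summing S p T q u C" "finite I" "\<And>i. i \<in> I \<Longrightarrow> x i \<in> fvec S"
    and "\<And>\<phi>. \<phi> \<in> dual_ball S p \<Longrightarrow> (\<Sum>i\<in>I. cmod (\<phi> (x i))) \<le> M"
  shows "(\<Sum>i\<in>I. q (u (x i))) \<le> C * M"
proof -
  obtain h where h: "bij_betw h {..<card I} I"
    using ex_bij_betw_nat_finite[OF assms(2)] by (auto simp: atLeast0LessThan)
  have hI: "x (h i) \<in> fvec S" if "i < card I" for i using h that assms(3) by (auto simp: bij_betw_def)
  have "(\<Sum>i\<in>I. q (u (x i))) = (\<Sum>i<card I. q (u (x (h i))))"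
    by (rule sum.reindex_bij_betw[OF h, symmetric])
  also have "\<dots> \<le> C * Sup {\<Sum>j<card I. cmod (\<phi> (x (h j))) | \<phi>. \<phi> \<in> dual_ball S p}"
    using assms(1)[unfolded summing_def, THEN conjunct2, rule_format, of "card I" "\<lambda>j. x (h j)"] hI by simp
  also have "\<dots> \<le> C * M"
  proof (rule mult_left_mono)
    show "0 \<le> C" using assms(1) by (simp add: summing_def)
    show "Sup {\<Sum>j<card I. cmod (\<phi> (x (h j))) | \<phi>. \<phi> \<in> dual_ball S p} \<le> M"
    proof (rule cSup_least)
      fix y assume "y \<in> {\<Sum>j<card I. cmod (\<phi> (x (h j))) | \<phi>. \<phi> \<in> dual_ball S p}"
      then obtain \<phi> where \<phi>: "\<phi> \<in> dual_ball S p" "y = (\<Sum>j<card I. cmod (\<phi> (x (h j))))" by blast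
      have "(\<Sum>j<card I. cmod (\<phi> (x (h j)))) = (\<Sum>i\<in>I. cmod (\<phi> (x i)))"
        by (rule sum.reindex_bij_betw[OF h])
      then show "y \<le> M" using assms(4)[OF \<phi>(1)] \<phi>(2) by simp
    next
      show "{\<Sum>j<card I. cmod (\<phi> (x (h j))) | \<phi>. \<phi> \<in> dual_ball S p} \<noteq> {}"
        using dual_ball_zero by (simp add: ex_in_conv) blast
    qed
  qed
  finally show ?thesis .
qed

text \<open>For a functional \<phi>, the phases conjugate to those of \<open>\<phi> (x i)\<close>
  turn the sum of moduli into the value of \<phi> at one signed sum, which is bounded by its norm.
  The signs range over \<open>cmod (\<epsilon> i) \<le> 1\<close> because
  \<open>sgn 0 = 0\<close>.\<close>

lemma summing_unimodular_le:
  assumes "summing S p T q u C" "finite I" "\<And>i. i \<in> I \<Longrightarrow> x i \<in> fvec S"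
    and "\<And>\<epsilon>. (\<And>i. cmod (\<epsilon> i) \<le> 1) \<Longrightarrow> p (\<lambda>a. \<Sum>i\<in>I. \<epsilon> i * x i a) \<le> M"
  shows "(\<Sum>i\<in>I. q (u (x i))) \<le> C * M"
proof (rule summing_le[OF assms(1-3)])
  fix \<phi> assume \<phi>: "\<phi> \<in> dual_ball S p"
  define \<epsilon> where "\<epsilon> i = cnj (sgn (\<phi> (x i)))" for i
  have e: "\<epsilon> i * \<phi> (x i) = cmod (\<phi> (x i))" for i
    by (simp add: \<epsilon>_def cnj_sgn_mult)
  have "complex_of_real (\<Sum>i\<in>I. cmod (\<phi> (x i))) = \<phi> (\<lambda>a. \<Sum>i\<in>I. \<epsilon> i * x i a)"
    using lin_functional_sum[OF dual_ballD(1)[OF \<phi>] assms(2), of x \<epsilon>] assms(3) e by simp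
  then have "(\<Sum>i\<in>I. cmod (\<phi> (x i))) = cmod (\<phi> (\<lambda>a. \<Sum>i\<in>I. \<epsilon> i * x i a))"
    by (simp only: norm_of_real abs_of_nonneg sum_nonneg norm_ge_zero flip: \<open>complex_of_real _ = _\<close>)
  also have "\<dots> \<le> p (\<lambda>a. \<Sum>i\<in>I. \<epsilon> i * x i a)"
    by (intro dual_ballD(2)[OF \<phi>] fvec_sum fvec_smult assms(3))
  also have "\<dots> \<le> M" by (rule assms(4)) (auto simp: \<epsilon>_def norm_sgn)
  finally show "(\<Sum>i\<in>I. cmod (\<phi> (x i))) \<le> M" .
qed (auto)

text \<open>Explicit members of the dual ball that recover all coordinates. They bound the supremum
  in \<open>summing\<close> from below and serve as sampling points for a concrete
  projection.\<close>

lemma scaled_coordinate_in_dual_ball: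
  assumes "B > 0" "\<And>x a. x \<in> fvec S \<Longrightarrow> cmod (x a) \<le> B * p x"
  shows "(\<lambda>x. x a / complex_of_real B) \<in> dual_ball S p"
  unfolding dual_ball_def mem_Collect_eq
proof (intro conjI ballI)
  fix x assume "x \<in> fvec S"
  from assms(2)[OF this, of a] show "cmod (x a / complex_of_real B) \<le> p x"
    using assms(1) by (simp add: norm_divide pos_divide_le_eq mult.commute)
qed (simp add: lin_functional_def add_divide_distrib)

text \<open>Each vector is expanded in unit vectors, and each coordinate is \<open>B\<close> times a
  functional in the dual ball. The result keeps the infimum \<open>pi1\<close> from ranging over the
  empty set.\<close>

lemma summing_exists:
  assumes "coord_normed T q" "is_op S T u"
  shows "\<exists>C. summing S p T q u C"
proof -
  interpret T: coord_normed T q by fact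
  obtain B where B: "B > 0" "\<And>x a. x \<in> fvec S \<Longrightarrow> cmod (x a) \<le> B * p x" using coordE by blast
  define C where "C = (\<Sum>\<alpha>\<in>S. B * q (u (unitv \<alpha>)))"
  have q: "q (u (unitv \<alpha>)) \<ge> 0" if "\<alpha> \<in> S" for \<alpha>
    using that T.nonneg is_op_fvec[OF assms(2)] by blast
  have "(\<Sum>j<k. q (u (xs j))) \<le> C * Sup {\<Sum>j<k. cmod (\<phi> (xs j)) | \<phi>. \<phi> \<in> dual_ball S p}" (is "_ \<le> C * ?M")
    if xs: "\<And>j. j < k \<Longrightarrow> xs j \<in> fvec S" for k :: nat and xs
  proof -
    have "(\<Sum>j<k. q (u (xs j))) \<le> (\<Sum>j<k. \<Sum>\<alpha>\<in>S. cmod (xs j \<alpha>) * q (u (unitv \<alpha>)))"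
    proof (rule sum_mono)
      fix j assume "j \<in> {..<k}"
      then have x: "xs j \<in> fvec S" using xs by auto
      have "u (xs j) = (\<lambda>b. \<Sum>\<alpha>\<in>S. xs j \<alpha> * u (unitv \<alpha>) b)"
        using is_op_sum[OF assms(2) fin, of unitv "xs j"] fvec_expand[OF fin x] by simp
      then show "q (u (xs j)) \<le> (\<Sum>\<alpha>\<in>S. cmod (xs j \<alpha>) * q (u (unitv \<alpha>)))"
        using T.norm_sum[OF fin, of "\<lambda>\<alpha>. u (unitv \<alpha>)" "xs j"] is_op_fvec[OF assms(2)] by auto
    qed
    also have "\<dots> = (\<Sum>\<alpha>\<in>S. B * q (u (unitv \<alpha>)) * (\<Sum>j<k. cmod (xs j \<alpha> / complex_of_real B)))"
      using B(1) by (subst sum.swap) (auto simp: sum_distrib_left norm_divide mult_ac intro!: sum.cong)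
    also have "\<dots> \<le> (\<Sum>\<alpha>\<in>S. B * q (u (unitv \<alpha>)) * ?M)"
    proof (intro sum_mono mult_left_mono)
      fix \<alpha> assume "\<alpha> \<in> S"
      show "(\<Sum>j<k. cmod (xs j \<alpha> / complex_of_real B)) \<le> ?M"
        using scaled_coordinate_in_dual_ball[OF B, of \<alpha>] dual_ball_bdd[OF xs]
        by (intro cSup_upper) auto
      show "0 \<le> B * q (u (unitv \<alpha>))" using q[OF \<open>\<alpha> \<in> S\<close>] B by simp
    qed
    finally show ?thesis by (simp add: C_def sum_distrib_right)
  qed
  moreover have "C \<ge> 0" unfolding C_def using q B by (intro sum_nonneg) auto
  ultimately show ?thesis unfolding summing_def by blast
qed

text \<open>A functional in the dual ball of the larger space restricts to one in the dual ball of
  the smaller, so the supremum on the right can only grow.\<close>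

lemma summing_restrict:
  assumes "summing S p T q u C" "coord_normed S' p'" "S' \<subseteq> S" "\<And>x. x \<in> fvec S' \<Longrightarrow> p x = p' x"
  shows "summing S' p' T q u C"
proof -
  interpret S': coord_normed S' p' by fact
  have "(\<Sum>j<k. q (u (xs j))) \<le> C * Sup {\<Sum>j<k. cmod (\<phi> (xs j)) | \<phi>. \<phi> \<in> dual_ball S' p'}"
    if xs: "\<And>j. j < k \<Longrightarrow> xs j \<in> fvec S'" for k :: nat and xs
  proof (rule summing_le[OF assms(1)])
    fix \<phi> assume "\<phi> \<in> dual_ball S p"
    then have "\<phi> \<in> dual_ball S' p'"
      using fvec_mono[OF assms(3)] unfolding dual_ball_def lin_functional_def
      by (simp add: assms(4)[symmetric])
    then show "(\<Sum>j<k. cmod (\<phi> (xs j))) \<le> Sup {\<Sum>j<k. cmod (\<phi> (xs j)) | \<phi>. \<phi> \<in> dual_ball S' p'}"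
      using S'.dual_ball_bdd[OF xs] by (intro cSup_upper) auto
  qed (use xs fvec_mono[OF assms(3)] in auto)
  then show ?thesis using assms(1) unfolding summing_def by blast
qed

lemma gl_const_le:
  assumes "0 \<le> B"
    and "\<And>M u C \<epsilon>. is_op S {..<M} u \<Longrightarrow> summing S p {..<M} (l2norm M) u C \<Longrightarrow> \<epsilon> > 0
      \<Longrightarrow> l1_factor S p {..<M} (l2norm M) u (B * C + \<epsilon>)"
  shows "gl_const S p \<le> B"
proof -
  have "gamma1 S p {..<M} (l2norm M) u \<le> B * pi1 S p {..<M} (l2norm M) u" if u: "is_op S {..<M} u" for M u
  proof -
    let ?g = "gamma1 S p {..<M} (l2norm M) u" and ?C = "{C. summing S p {..<M} (l2norm M) u C}"
    have C: "?g \<le> B * C" if "C \<in> ?C" for C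
    proof (rule field_le_epsilon)
      fix \<epsilon> :: real assume "0 < \<epsilon>"
      moreover have "0 \<le> C" using that by (simp add: summing_def)
      ultimately show "?g \<le> B * C + \<epsilon>"
        using gamma1_le[OF coord_normed_axioms coord_normed_l2 assms(2)[OF u]] that assms(1) by simp
    qed
    have ne: "?C \<noteq> {}" using summing_exists[OF coord_normed_l2 u] by blast
    show ?thesis
    proof (cases "B = 0")
      case True
      then show ?thesis using C ne by auto
    next
      case False
      then have "B > 0" using assms(1) by simp
      \<comment> \<open>Dividing by \<open>B\<close> makes \<open>?g / B\<close> a lower bound of
        all admissible constants; for \<open>B = 0\<close> a single admissible constant already
        gives \<open>?g \<le> 0\<close>.\<close>
      then have "?g / B \<le> Inf ?C" using C by (intro cInf_greatest[OF ne]) (simp add: field_simps)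
      then show ?thesis using \<open>B > 0\<close> by (simp add: pi1_summing field_simps)
    qed
  qed
  then show ?thesis unfolding gl_const_def using assms(1) by (intro cInf_lower bdd_belowI[of _ 0]) auto
qed

end

subsection \<open>Projections from \<open>\<ell>\<^sub>\<infinity>\<close> onto a finite-dimensional space\<close>

lemma csubspace_linf: "csubspace (linf K)"
  unfolding csubspace_def linf_def
proof (intro conjI ballI allI)
  fix f g assume "f \<in> {f \<in> fvec K. \<exists>B. \<forall>k\<in>K. cmod (f k) \<le> B}" "g \<in> {f \<in> fvec K. \<exists>B. \<forall>k\<in>K. cmod (f k) \<le> B}"
  then obtain B B' where *: "f \<in> fvec K" "g \<in> fvec K" "\<forall>k\<in>K. cmod (f k) \<le> B" "\<forall>k\<in>K. cmod (g k) \<le> B'" by blast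
  then have "\<forall>k\<in>K. cmod (f k + g k) \<le> B + B'" by (meson add_mono norm_triangle_le)
  then show "(\<lambda>a. f a + g a) \<in> {f \<in> fvec K. \<exists>B. \<forall>k\<in>K. cmod (f k) \<le> B}" using * by auto
next
  fix c f assume "f \<in> {f \<in> fvec K. \<exists>B. \<forall>k\<in>K. cmod (f k) \<le> B}"
  then obtain B where *: "f \<in> fvec K" "\<forall>k\<in>K. cmod (f k) \<le> B" by blast
  then have "\<forall>k\<in>K. cmod (c * f k) \<le> cmod c * B" by (auto simp: norm_mult intro: mult_left_mono)
  then show "(\<lambda>a. c * f a) \<in> {f \<in> fvec K. \<exists>B. \<forall>k\<in>K. cmod (f k) \<le> B}" using * by auto
qed auto

lemma linfI: "(\<And>k. k \<notin> K \<Longrightarrow> f k = 0) \<Longrightarrow> (\<And>k. k \<in> K \<Longrightarrow> cmod (f k) \<le> B) \<Longrightarrow> f \<in> linf K"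
  by (auto simp: linf_def fvec_def)

lemma supnorm_upper:
  assumes "f \<in> linf K" "k \<in> K"
  shows "cmod (f k) \<le> supnorm K f"
  unfolding supnorm_def using assms by (intro cSup_upper) (auto simp: linf_def bdd_above_def)

lemma supnorm_least: "K \<noteq> {} \<Longrightarrow> (\<And>k. k \<in> K \<Longrightarrow> cmod (f k) \<le> B) \<Longrightarrow> supnorm K f \<le> B"
  unfolding supnorm_def by (rule cSup_least) auto

definition proj_norm :: "'a set \<Rightarrow> (('a \<Rightarrow> complex) \<Rightarrow> real)
    \<Rightarrow> (((('a \<Rightarrow> complex) \<Rightarrow> complex) \<Rightarrow> complex) \<Rightarrow> ('a \<Rightarrow> complex)) \<Rightarrow> real" where
  "proj_norm S p P = Sup {p (P f) | f. f \<in> linf (dual_ball S p) \<and> supnorm (dual_ball S p) f \<le> 1}"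

lemma is_projectionD:
  assumes "is_projection S p P"
  shows "\<And>f. f \<in> linf (dual_ball S p) \<Longrightarrow> P f \<in> fvec S" "lin_on (linf (dual_ball S p)) P"
    "\<exists>B. \<forall>f\<in>linf (dual_ball S p). p (P f) \<le> B * supnorm (dual_ball S p) f"
    "\<And>x. x \<in> fvec S \<Longrightarrow> P (dual_emb S p x) = x"
  using assms unfolding is_projection_def lin_on_def Let_def by blast+

context coord_normed
begin

lemma dual_emb_linf: "x \<in> fvec S \<Longrightarrow> dual_emb S p x \<in> linf (dual_ball S p)"
  by (rule linfI[of _ _ "p x"]) (auto simp: dual_emb_def dual_ballD(2))

lemma proj_norm_bdd:
  assumes "is_projection S p P"
  shows "bdd_above {p (P f) | f. f \<in> linf (dual_ball S p) \<and> supnorm (dual_ball S p) f \<le> 1}"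
proof -
  let ?K = "dual_ball S p"
  obtain B where B: "\<forall>f\<in>linf ?K. p (P f) \<le> B * supnorm ?K f"
    using is_projectionD(3)[OF assms] by blast
  have "p (P f) \<le> \<bar>B\<bar>" if f: "f \<in> linf ?K" "supnorm ?K f \<le> 1" for f
  proof -
    have "0 \<le> supnorm ?K f" using supnorm_upper[OF f(1) dual_ball_zero] norm_ge_zero order_trans by blast
    have "p (P f) \<le> B * supnorm ?K f" using B f by blast
    also have "\<dots> \<le> \<bar>B\<bar> * 1" using f(2) \<open>0 \<le> supnorm ?K f\<close> by (intro mult_mono) auto
    finally show ?thesis by simp
  qed
  then show ?thesis by (auto intro!: bdd_aboveI[of _ "\<bar>B\<bar>"])
qed

lemma proj_norm_upper:
  assumes "is_projection S p P" "f \<in> linf (dual_ball S p)" "\<And>\<phi>. \<phi> \<in> dual_ball S p \<Longrightarrow> cmod (f \<phi>) \<le> B"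
  shows "p (P f) \<le> proj_norm S p P * B"
proof -
  let ?K = "dual_ball S p"
  have B0: "B \<ge> 0" using assms(3)[OF dual_ball_zero] norm_ge_zero order_trans by blast
  note lin = is_projectionD(2)[OF assms(1)]
  show ?thesis
  proof (cases "B = 0")
    case True
    have "f = (\<lambda>_. 0)" using assms(2,3) True by (fastforce simp: linf_def fvec_def)
    then show ?thesis using lin_on_zero[OF csubspace_linf lin] True zero by simp
  next
    case False
    then have B: "B > 0" using B0 by simp
    define c where "c = complex_of_real (1 / B)"
    have cn: "cmod c = 1 / B" using B by (simp add: c_def norm_divide)
    have g: "(\<lambda>k. c * f k) \<in> linf ?K" by (rule csubspace_smult[OF csubspace_linf assms(2)])
    have "supnorm ?K (\<lambda>k. c * f k) \<le> 1"
      using assms(3) B dual_ball_zero by (intro supnorm_least) (auto simp: norm_mult cn)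
    then have "p (P (\<lambda>k. c * f k)) \<le> proj_norm S p P"
      unfolding proj_norm_def using g by (intro cSup_upper proj_norm_bdd[OF assms(1)]) auto
    moreover have "P (\<lambda>k. c * f k) = (\<lambda>a. c * P f a)" by (rule lin_on_smult[OF lin assms(2)])
    ultimately have "(1 / B) * p (P f) \<le> proj_norm S p P"
      using hom[OF is_projectionD(1)[OF assms(1,2)], of c] by (simp add: cn)
    then show ?thesis using B by (simp add: pos_divide_le_eq)
  qed
qed

lemma proj_norm_nonneg:
  assumes "is_projection S p P"
  shows "0 \<le> proj_norm S p P"
proof -
  have "(\<lambda>_. 0) \<in> linf (dual_ball S p)" by (rule csubspace_zero[OF csubspace_linf])
  then have "p (P (\<lambda>_. 0)) \<le> proj_norm S p P * 1" "0 \<le> p (P (\<lambda>_. 0))"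
    using proj_norm_upper[OF assms, of "\<lambda>_. 0" 1] nonneg is_projectionD(1)[OF assms] by auto
  then show ?thesis by simp
qed

text \<open>The scaled coordinate functionals are points of the dual ball, so the coordinates of
  \<open>x\<close> can be read off from its embedded image at these finitely many points. Sampling
  an arbitrary bounded function there gives a projection.\<close>

lemma projection_exists: "\<exists>P. is_projection S p P"
proof -
  let ?K = "dual_ball S p"
  obtain B where B: "B > 0" "\<And>x a. x \<in> fvec S \<Longrightarrow> cmod (x a) \<le> B * p x" using coordE by blast
  define \<xi> where "\<xi> a = (\<lambda>x::'a \<Rightarrow> complex. x a / complex_of_real B)" for a
  have \<xi>: "\<xi> a \<in> ?K" for a unfolding \<xi>_def by (rule scaled_coordinate_in_dual_ball[OF B])
  define P where "P f = (\<lambda>a. if a \<in> S then complex_of_real B * f (\<xi> a) else 0)" for f :: "(('a \<Rightarrow> complex) \<Rightarrow> complex) \<Rightarrow> complex"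
  have Pf: "P f \<in> fvec S" for f by (auto simp: P_def fvec_def)
  have "p (P f) \<le> (\<Sum>\<alpha>\<in>S. B * p (unitv \<alpha>)) * supnorm ?K f" if f: "f \<in> linf ?K" for f
  proof -
    have "p (P f) \<le> (\<Sum>\<alpha>\<in>S. cmod (P f \<alpha>) * p (unitv \<alpha>))"
      using norm_sum[OF fin, of unitv "P f"] fvec_expand[OF fin Pf, of f] by simp
    also have "\<dots> \<le> (\<Sum>\<alpha>\<in>S. (B * supnorm ?K f) * p (unitv \<alpha>))"
      using supnorm_upper[OF f \<xi>] B(1) nonneg
      by (intro sum_mono mult_right_mono) (auto simp: P_def norm_mult intro!: mult_left_mono)
    finally show ?thesis by (simp add: sum_distrib_left sum_distrib_right mult_ac)
  qed
  moreover have "P (dual_emb S p x) = x" if "x \<in> fvec S" for x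
    using that \<xi> B(1) by (auto simp: P_def dual_emb_def fun_eq_iff fvec_def) (simp add: \<xi>_def)
  ultimately have "is_projection S p P"
    unfolding is_projection_def Let_def
    using Pf by (intro conjI exI[of _ "\<Sum>\<alpha>\<in>S. B * p (unitv \<alpha>)"])
      (auto simp: P_def fun_eq_iff algebra_simps)
  then show ?thesis by blast
qed

lemma proj_const_eq: "proj_const S p = Inf {proj_norm S p P | P. is_projection S p P}"
  by (simp add: proj_const_def proj_norm_def)

lemma proj_const_approx:
  assumes "\<delta> > 0"
  obtains P where "is_projection S p P" "proj_norm S p P < proj_const S p + \<delta>"
proof -
  have "{proj_norm S p P | P. is_projection S p P} \<noteq> {}" using projection_exists by blast
  then have "\<exists>x\<in>{proj_norm S p P | P. is_projection S p P}. x < proj_const S p + \<delta>"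
    unfolding proj_const_eq by (intro cInf_lessD) (use assms in auto)
  then show ?thesis using that by blast
qed

lemma proj_const_nonneg: "0 \<le> proj_const S p"
  unfolding proj_const_eq using projection_exists proj_norm_nonneg by (intro cInf_greatest) auto

text \<open>Every projection returns an embedded vector unchanged, and the embedding does not
  increase its norm.\<close>

lemma proj_const_ge_1:
  assumes "S \<noteq> {}"
  shows "1 \<le> proj_const S p"
  unfolding proj_const_eq
proof (rule cInf_greatest)
  fix y assume "y \<in> {proj_norm S p P | P. is_projection S p P}"
  then obtain P where P: "is_projection S p P" "y = proj_norm S p P" by blast
  obtain \<alpha> where \<alpha>: "\<alpha> \<in> S" using assms by blast
  let ?x = "unitv \<alpha> :: 'a \<Rightarrow> complex"
  have x: "?x \<in> fvec S" using \<alpha> by simp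
  have "?x \<noteq> (\<lambda>_. 0)" by (auto simp: unitv_def fun_eq_iff)
  then have pos: "p ?x > 0" using nonneg[OF x] eq_zero[OF x] by fastforce
  have "p (P (dual_emb S p ?x)) \<le> proj_norm S p P * p ?x"
    by (rule proj_norm_upper[OF P(1) dual_emb_linf[OF x]]) (auto simp: dual_emb_def dual_ballD(2)[OF _ x])
  then show "1 \<le> y" using is_projectionD(4)[OF P(1) x] pos P(2) by simp
qed (use projection_exists in blast)

text \<open>A functional is determined by its values at the unit vectors, which are bounded on the
  dual ball. Cutting the range of these values into small squares leaves finitely many cells, and
  \<open>r\<close> picks one functional from each. The representative is itself taken from the dual
  ball, so its norm bound is kept.\<close>

lemma dual_ball_net:
  assumes "\<delta> > 0"
  obtains r where "\<And>\<phi>. \<phi> \<in> dual_ball S p \<Longrightarrow> r \<phi> \<in> dual_ball S p" "finite (r ` dual_ball S p)"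
    "\<And>\<phi> x. \<phi> \<in> dual_ball S p \<Longrightarrow> x \<in> fvec S \<Longrightarrow> cmod (\<phi> x - r \<phi> x) \<le> (\<Sum>\<alpha>\<in>S. cmod (x \<alpha>)) * \<delta>"
proof -
  let ?K = "dual_ball S p"
  \<comment> \<open>Squares of side \<open>\<delta>/2\<close>: the errors in the real and imaginary
    parts together stay below \<delta>.\<close>
  define cell where "cell \<phi> = (\<lambda>\<alpha>\<in>S. (\<lfloor>Re (\<phi> (unitv \<alpha>)) / (\<delta>/2)\<rfloor>, \<lfloor>Im (\<phi> (unitv \<alpha>)) / (\<delta>/2)\<rfloor>))"
    for \<phi> :: "('a \<Rightarrow> complex) \<Rightarrow> complex"
  define b where "b \<alpha> = p (unitv \<alpha>) / (\<delta>/2)" for \<alpha>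
  have "cell \<phi> \<in> PiE S (\<lambda>\<alpha>. {\<lfloor>- b \<alpha>\<rfloor>..\<lfloor>b \<alpha>\<rfloor>} \<times> {\<lfloor>- b \<alpha>\<rfloor>..\<lfloor>b \<alpha>\<rfloor>})" if "\<phi> \<in> ?K" for \<phi>
  proof -
    have "- b \<alpha> \<le> Re (\<phi> (unitv \<alpha>)) / (\<delta>/2) \<and> Re (\<phi> (unitv \<alpha>)) / (\<delta>/2) \<le> b \<alpha> \<and>
      - b \<alpha> \<le> Im (\<phi> (unitv \<alpha>)) / (\<delta>/2) \<and> Im (\<phi> (unitv \<alpha>)) / (\<delta>/2) \<le> b \<alpha>" if "\<alpha> \<in> S" for \<alpha>
    proof -
      have "cmod (\<phi> (unitv \<alpha>)) \<le> p (unitv \<alpha>)" using dual_ballD(2)[OF \<open>\<phi> \<in> ?K\<close>] that by simp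
      then have "\<bar>Re (\<phi> (unitv \<alpha>))\<bar> \<le> p (unitv \<alpha>)" "\<bar>Im (\<phi> (unitv \<alpha>))\<bar> \<le> p (unitv \<alpha>)"
        using abs_Re_le_cmod abs_Im_le_cmod order_trans by blast+
      then show ?thesis using assms by (auto simp: b_def field_simps abs_le_iff)
    qed
    then show ?thesis unfolding cell_def by (auto intro!: floor_mono)
  qed
  then have "cell ` ?K \<subseteq> PiE S (\<lambda>\<alpha>. {\<lfloor>- b \<alpha>\<rfloor>..\<lfloor>b \<alpha>\<rfloor>} \<times> {\<lfloor>- b \<alpha>\<rfloor>..\<lfloor>b \<alpha>\<rfloor>})" by blast
  then have fc: "finite (cell ` ?K)" by (rule finite_subset) (auto intro!: finite_PiE fin)
  define rep where "rep c = (SOME \<psi>. \<psi> \<in> ?K \<and> cell \<psi> = c)" for c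
  have rep: "rep (cell \<phi>) \<in> ?K \<and> cell (rep (cell \<phi>)) = cell \<phi>" if "\<phi> \<in> ?K" for \<phi>
    unfolding rep_def by (rule someI[of _ \<phi>]) (use that in auto)
  have unit: "cmod (\<phi> (unitv \<alpha>) - \<psi> (unitv \<alpha>)) \<le> \<delta>" if "cell \<psi> = cell \<phi>" "\<alpha> \<in> S" for \<phi> \<psi> \<alpha>
  proof -
    have fl: "\<bar>x - y\<bar> \<le> \<delta>/2" if "\<lfloor>x / (\<delta>/2)\<rfloor> = \<lfloor>y / (\<delta>/2)\<rfloor>" for x y :: real
    proof -
      have "(x - y) / (\<delta>/2) \<le> 1" "(y - x) / (\<delta>/2) \<le> 1"
        using that unfolding diff_divide_distrib by linarith+
      then have "x - y \<le> \<delta>/2" "y - x \<le> \<delta>/2"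
        using assms by (simp_all only: pos_divide_le_eq half_gt_zero mult_1)
      then show ?thesis by linarith
    qed
    have "cell \<phi> \<alpha> = cell \<psi> \<alpha>" using that by simp
    then have fl_eq: "\<lfloor>Re (\<phi> (unitv \<alpha>)) / (\<delta>/2)\<rfloor> = \<lfloor>Re (\<psi> (unitv \<alpha>)) / (\<delta>/2)\<rfloor>"
      "\<lfloor>Im (\<phi> (unitv \<alpha>)) / (\<delta>/2)\<rfloor> = \<lfloor>Im (\<psi> (unitv \<alpha>)) / (\<delta>/2)\<rfloor>"
      using that(2) by (simp_all only: cell_def restrict_apply' prod.inject)
    have "\<bar>Re (\<phi> (unitv \<alpha>)) - Re (\<psi> (unitv \<alpha>))\<bar> \<le> \<delta>/2" "\<bar>Im (\<phi> (unitv \<alpha>)) - Im (\<psi> (unitv \<alpha>))\<bar> \<le> \<delta>/2"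
      using fl_eq by (blast intro: fl)+
    then show ?thesis using cmod_le[of "\<phi> (unitv \<alpha>) - \<psi> (unitv \<alpha>)"] by simp
  qed
  show ?thesis
  proof (rule that[of "\<lambda>\<phi>. rep (cell \<phi>)"])
    show "finite ((\<lambda>\<phi>. rep (cell \<phi>)) ` ?K)" using finite_imageI[OF fc, of rep] by (simp add: image_image)
  next
    fix \<phi> x assume *: "\<phi> \<in> ?K" "x \<in> fvec S"
    let ?\<psi> = "rep (cell \<phi>)"
    have ex: "\<psi> x = (\<Sum>\<alpha>\<in>S. x \<alpha> * \<psi> (unitv \<alpha>))" if "\<psi> \<in> ?K" for \<psi>
      using lin_functional_sum[OF dual_ballD(1)[OF that] fin, of unitv x] fvec_expand[OF fin *(2)] by simp
    have "\<phi> x - ?\<psi> x = (\<Sum>\<alpha>\<in>S. x \<alpha> * (\<phi> (unitv \<alpha>) - ?\<psi> (unitv \<alpha>)))"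
      unfolding ex[OF *(1)] ex[OF conjunct1[OF rep[OF *(1)]]] by (simp add: sum_subtractf right_diff_distrib)
    also have "cmod \<dots> \<le> (\<Sum>\<alpha>\<in>S. cmod (x \<alpha>) * \<delta>)"
      using unit rep[OF *(1)] by (intro sum_norm_le) (auto simp: norm_mult intro!: mult_left_mono)
    finally show "cmod (\<phi> x - ?\<psi> x) \<le> (\<Sum>\<alpha>\<in>S. cmod (x \<alpha>)) * \<delta>" by (simp add: sum_distrib_right)
  qed (use rep in auto)
qed

end

lemma lin_on_compose:
  assumes "lin_on V L" "\<And>x. x \<in> V \<Longrightarrow> L x \<in> W" "lin_on W L'"
  shows "lin_on V (\<lambda>x. L' (L x))"
  using assms by (simp add: lin_on_def)

text \<open>Replacing the dual ball by a finite net \<open>r ` dual_ball G pG\<close> turns the evaluations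
  \<open>x \<mapsto> \<phi> (D k x)\<close> into finitely many functionals, which factor an approximation of \<open>u\<close> through
  \<open>\<ell>\<^sub>1\<close>; the summing property, tested against unimodular signs, bounds its norm. The error
  is arbitrarily small because \<open>S\<close> and \<open>G\<close> are finite.\<close>

lemma l1_factor_via_projection:
  fixes D :: "'k \<Rightarrow> ('a \<Rightarrow> complex) \<Rightarrow> ('g \<Rightarrow> complex)"
    and R :: "'k \<Rightarrow> ('g \<Rightarrow> complex) \<Rightarrow> ('a \<Rightarrow> complex)"
  assumes "coord_normed S p" "coord_normed G pG" "coord_normed T q"
    and P: "is_projection G pG P" and A: "finite A"
    and D: "\<And>k. k \<in> A \<Longrightarrow> is_op S G (D k)" and R: "\<And>k. k \<in> A \<Longrightarrow> is_op G S (R k)"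
    and RD: "\<And>x. x \<in> fvec S \<Longrightarrow> (\<lambda>a. \<Sum>k\<in>A. R k (D k x) a) = x"
    and bound: "\<And>x g r. x \<in> fvec S \<Longrightarrow> (\<And>k. k \<in> A \<Longrightarrow> g k \<in> linf (dual_ball G pG)) \<Longrightarrow>
       (\<And>\<phi>. \<phi> \<in> dual_ball G pG \<Longrightarrow> r \<phi> \<in> dual_ball G pG) \<Longrightarrow>
       (\<And>k \<phi>. k \<in> A \<Longrightarrow> \<phi> \<in> dual_ball G pG \<Longrightarrow> cmod (g k \<phi>) \<le> cmod (r \<phi> (D k x))) \<Longrightarrow>
       p (\<lambda>a. \<Sum>k\<in>A. R k (P (g k)) a) \<le> B * p x"
    and u: "is_op S T u" "summing S p T q u C" and "\<epsilon> > 0"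
  shows "l1_factor S p T q u (B * C + \<epsilon>)"
proof -
  interpret S: coord_normed S p by fact
  interpret G: coord_normed G pG by fact
  interpret T: coord_normed T q by fact
  let ?K = "dual_ball G pG"
  note Plin = is_projectionD(2)[OF P] and PG = is_projectionD(1)[OF P] and Pemb = is_projectionD(4)[OF P]
  \<comment> \<open>\<open>V k\<close> extends \<open>u\<close> after \<open>R k\<close> from the
    embedded space over \<open>G\<close> to all of \<open>linf ?K\<close>, where it can be applied
    to indicator functions.\<close>
  define V where "V k f = u (R k (P f))" for k f
  have VT: "V k f \<in> fvec T" if "k \<in> A" "f \<in> linf ?K" for k f
    unfolding V_def using that by (intro is_op_fvec[OF u(1)] is_op_fvec[OF R] PG)
  have Vlin: "lin_on (linf ?K) (V k)" if "k \<in> A" for k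
  proof -
    have "lin_on (fvec G) (\<lambda>y. u (R k y))"
      by (rule lin_on_compose[of _ "R k" "fvec S"]) (use R[OF that] u(1) in \<open>auto simp: is_op_lin_on\<close>)
    from lin_on_compose[OF Plin PG this] show ?thesis by (simp add: V_def[abs_def])
  qed
  obtain bu where bu: "bu \<ge> 0" "\<And>x. x \<in> fvec S \<Longrightarrow> q (u x) \<le> bu * p x"
    using S.lin_bounded[OF assms(3) u(1)] by blast
  have "\<forall>k\<in>A. \<exists>b. b \<ge> 0 \<and> (\<forall>y\<in>fvec G. p (R k y) \<le> b * pG y)"
    using G.lin_bounded[OF assms(1) R] by metis
  then obtain bR where bR: "\<And>k. k \<in> A \<Longrightarrow> bR k \<ge> 0" "\<And>k y. k \<in> A \<Longrightarrow> y \<in> fvec G \<Longrightarrow> p (R k y) \<le> bR k * pG y"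
    by metis
  \<comment> \<open>A crude bound on \<open>V k\<close>, which enters the error term only.\<close>
  define bV where "bV k = bu * (bR k * proj_norm G pG P)" for k
  have bV: "bV k \<ge> 0" if "k \<in> A" for k
    using that bu bR G.proj_norm_nonneg[OF P] by (simp add: bV_def)
  have Vn: "q (V k f) \<le> bV k * M" if k: "k \<in> A" and f: "f \<in> linf ?K" "\<And>\<phi>. \<phi> \<in> ?K \<Longrightarrow> cmod (f \<phi>) \<le> M" for k f M
  proof -
    have "q (V k f) \<le> bu * p (R k (P f))"
      unfolding V_def using k f by (intro bu is_op_fvec[OF R] PG)
    also have "\<dots> \<le> bu * (bR k * pG (P f))"
      using k f bu by (intro mult_left_mono bR PG)
    also have "\<dots> \<le> bu * (bR k * (proj_norm G pG P * M))"
      using k bu bR by (intro mult_left_mono G.proj_norm_upper[OF P f]) auto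
    finally show ?thesis by (simp add: bV_def mult_ac)
  qed
  have uV: "u x = (\<lambda>b. \<Sum>k\<in>A. V k (dual_emb G pG (D k x)) b)" if x: "x \<in> fvec S" for x
  proof -
    have DG: "D k x \<in> fvec G" if "k \<in> A" for k using D[OF that] x by (rule is_op_fvec)
    have "u x = u (\<lambda>a. \<Sum>k\<in>A. 1 * R k (D k x) a)" using RD[OF x] by simp
    also have "\<dots> = (\<lambda>b. \<Sum>k\<in>A. 1 * u (R k (D k x)) b)"
      using DG by (intro is_op_sum[OF u(1) A] is_op_fvec[OF R])
    also have "\<dots> = (\<lambda>b. \<Sum>k\<in>A. V k (dual_emb G pG (D k x)) b)"
      using DG by (simp add: V_def Pemb)
    finally show ?thesis .
  qed
  obtain B0 where B0: "B0 > 0" "\<And>x a. x \<in> fvec S \<Longrightarrow> cmod (x a) \<le> B0 * p x" using S.coordE by blast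
  \<comment> \<open>\<open>W\<close> collects all crude constants of the error term, summed over the
    unit vectors of \<open>S\<close>; adding 1 in the denominator of \<delta> keeps it
    positive.\<close>
  define W where "W = B0 * (\<Sum>\<alpha>\<in>S. \<Sum>k\<in>A. bV k * (\<Sum>\<beta>\<in>G. cmod (D k (unitv \<alpha>) \<beta>)))"
  have W0: "W \<ge> 0" unfolding W_def using B0(1) bV by (intro mult_nonneg_nonneg sum_nonneg) auto
  define \<delta> where "\<delta> = \<epsilon> / (W + 1)"
  have \<delta>: "\<delta> > 0" "W * \<delta> \<le> \<epsilon>" using W0 \<open>\<epsilon> > 0\<close> by (auto simp: \<delta>_def field_simps)
  obtain r where r: "\<And>\<phi>. \<phi> \<in> ?K \<Longrightarrow> r \<phi> \<in> ?K" "finite (r ` ?K)"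
    "\<And>\<phi> x. \<phi> \<in> ?K \<Longrightarrow> x \<in> fvec G \<Longrightarrow> cmod (\<phi> x - r \<phi> x) \<le> (\<Sum>\<alpha>\<in>G. cmod (x \<alpha>)) * \<delta>"
    using G.dual_ball_net[OF \<delta>(1)] by blast
  \<comment> \<open>Indicator functions of the cells of \<open>r\<close>. Their combinations are the
    step functions \<phi> \<mapsto> h (r \<phi>) on \<open>?K\<close>.\<close>
  define \<kappa> where "\<kappa> l = (\<lambda>\<phi>. if \<phi> \<in> ?K \<and> r \<phi> = l then 1 else 0 :: complex)" for l
  have \<kappa>: "\<kappa> l \<in> linf ?K" for l by (rule linfI[of _ _ 1]) (auto simp: \<kappa>_def)
  have \<kappa>_sum: "(\<Sum>l\<in>r ` ?K. h l * \<kappa> l \<phi>) = (if \<phi> \<in> ?K then h (r \<phi>) else 0)" for h :: "_ \<Rightarrow> complex" and \<phi>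
    using r(2) by (auto simp: \<kappa>_def if_distrib[of "\<lambda>z. _ * z"] cong: if_cong)
  have V\<kappa>: "(\<lambda>b. \<Sum>l\<in>r ` ?K. h l * V k (\<kappa> l) b) = V k (\<lambda>\<phi>. if \<phi> \<in> ?K then h (r \<phi>) else 0)" if "k \<in> A" for k h
    using lin_on_sum[OF csubspace_linf Vlin[OF that] r(2), of \<kappa> h] \<kappa> \<kappa>_sum by simp
  let ?I = "A \<times> r ` ?K"
  have fI: "finite ?I" using A r(2) by simp
  define f where "f = (\<lambda>(k,l) x. l (D k x) :: complex)"
  define y where "y = (\<lambda>(k,l). V k (\<kappa> l))"
  \<comment> \<open>The approximation of \<open>u\<close> in which the embedded vector \<phi>
    \<mapsto> \<phi> (D k x) is replaced by the step function \<phi> \<mapsto> r \<phi> (D k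
    x).\<close>
  define u' where "u' x = (\<lambda>b. \<Sum>i\<in>?I. f i x * y i b)" for x
  have flin: "lin_functional S (f i)" if i: "i \<in> ?I" for i
  proof -
    obtain k l where kl: "i = (k,l)" "k \<in> A" "l \<in> ?K" using i r(1) by auto
    show ?thesis using D[OF kl(2)] dual_ballD(1)[OF kl(3)]
      unfolding kl(1) f_def lin_functional_def is_op_def by simp
  qed
  have yT: "y i \<in> fvec T" if "i \<in> ?I" for i using that VT \<kappa> by (auto simp: y_def)

  have "l1_factor S p T q u' (B * C)"
  proof (rule l1_factorI[of ?I _ f y])
    fix x assume x: "x \<in> fvec S"
    have DG: "D k x \<in> fvec G" if "k \<in> A" for k using D[OF that] x by (rule is_op_fvec)
    \<comment> \<open>The weights \<open>cmod (f i x)\<close> are moved onto the vectors: the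
      l_1-norm becomes a sum of \<open>q (u (z i))\<close>, to which the summing property
      applies.\<close>
    define z where "z = (\<lambda>(k,l) a. complex_of_real (cmod (f (k,l) x)) * R k (P (\<kappa> l)) a)"
    have RS: "R k (P (\<kappa> l)) \<in> fvec S" if "k \<in> A" for k l
      using that by (intro is_op_fvec[OF R] PG \<kappa>)
    have zS: "z i \<in> fvec S" if "i \<in> ?I" for i using that RS by (auto simp: z_def)
    have "(\<Sum>i\<in>?I. cmod (f i x) * q (y i)) = (\<Sum>i\<in>?I. q (u (z i)))"
    proof (rule sum.cong)
      fix i assume i: "i \<in> ?I"
      obtain k l where kl: "i = (k,l)" "k \<in> A" using i by auto
      have "u (z i) = (\<lambda>b. complex_of_real (cmod (f i x)) * y i b)"
        using u(1) RS[OF kl(2), of l] unfolding kl(1) z_def y_def V_def is_op_def by simp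
      then show "cmod (f i x) * q (y i) = q (u (z i))" using T.hom[OF yT[OF i]] by simp
    qed simp
    also have "\<dots> \<le> C * (B * p x)"
    proof (rule S.summing_unimodular_le[OF u(2) fI zS])
      fix e :: "'k \<times> (('g \<Rightarrow> complex) \<Rightarrow> complex) \<Rightarrow> complex" assume e: "\<And>i. cmod (e i) \<le> 1"
      \<comment> \<open>For fixed \<open>k\<close>, the signs and weights of the cells combine into
        one step function \<open>g k\<close> dominated by \<phi> \<mapsto> cmod (r \<phi> (D k x));
        this is the situation of the hypothesis \<open>bound\<close>.\<close>
      define g where "g k = (\<lambda>\<phi>. if \<phi> \<in> ?K then e (k, r \<phi>) * complex_of_real (cmod (f (k, r \<phi>) x)) else 0)" for k
      have gle: "cmod (g k \<phi>) \<le> cmod (r \<phi> (D k x))" if "\<phi> \<in> ?K" for k \<phi>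
        using that mult_right_mono[OF e[of "(k, r \<phi>)"], of "cmod (r \<phi> (D k x))"]
        by (simp add: g_def f_def norm_mult)
      have gl: "g k \<in> linf ?K" if "k \<in> A" for k
      proof (rule linfI[of _ _ "pG (D k x)"])
        fix \<phi> assume \<phi>: "\<phi> \<in> ?K"
        have "cmod (g k \<phi>) \<le> cmod (r \<phi> (D k x))" by (rule gle[OF \<phi>])
        also have "\<dots> \<le> pG (D k x)" using dual_ballD(2)[OF r(1)[OF \<phi>] DG[OF that]] by simp
        finally show "cmod (g k \<phi>) \<le> pG (D k x)" .
      qed (simp add: g_def)
      have Rg: "(\<lambda>a. \<Sum>l\<in>r ` ?K. e (k,l) * z (k,l) a) = R k (P (g k))" if k: "k \<in> A" for k
      proof -
        have lin: "lin_on (linf ?K) (\<lambda>h. R k (P h))"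
          by (rule lin_on_compose[OF Plin PG]) (use k R in \<open>auto simp: is_op_lin_on\<close>)
        have "(\<lambda>a. \<Sum>l\<in>r ` ?K. (e (k,l) * complex_of_real (cmod (f (k,l) x))) * R k (P (\<kappa> l)) a)
          = R k (P (\<lambda>\<phi>. \<Sum>l\<in>r ` ?K. (e (k,l) * complex_of_real (cmod (f (k,l) x))) * \<kappa> l \<phi>))"
          by (rule lin_on_sum[OF csubspace_linf lin r(2) \<kappa>, symmetric])
        then show ?thesis unfolding \<kappa>_sum by (simp add: g_def z_def mult.assoc)
      qed
      have "(\<lambda>a. \<Sum>i\<in>?I. e i * z i a) = (\<lambda>a. \<Sum>k\<in>A. R k (P (g k)) a)"
      proof
        fix a
        have "(\<Sum>i\<in>?I. e i * z i a) = (\<Sum>k\<in>A. \<Sum>l\<in>r ` ?K. e (k,l) * z (k,l) a)"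
          by (simp add: sum.cartesian_product)
        also have "\<dots> = (\<Sum>k\<in>A. R k (P (g k)) a)"
          using fun_cong[OF Rg, of _ a] by (intro sum.cong) auto
        finally show "(\<Sum>i\<in>?I. e i * z i a) = (\<Sum>k\<in>A. R k (P (g k)) a)" .
      qed
      moreover have "p (\<lambda>a. \<Sum>k\<in>A. R k (P (g k)) a) \<le> B * p x"
        by (rule bound[where r = r]) (use x gl r(1) gle in auto)
      ultimately show "p (\<lambda>a. \<Sum>i\<in>?I. e i * z i a) \<le> B * p x" by simp
    qed
    finally show "(\<Sum>i\<in>?I. cmod (f i x) * q (y i)) \<le> B * C * p x" by (simp add: mult_ac)
  qed (use fI flin yT in \<open>simp_all add: u'_def\<close>)
  moreover have "l1_factor S p T q (\<lambda>x b. u x b - u' x b) \<epsilon>"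
  proof -
    let ?err = "\<lambda>x b. u x b - u' x b"
    have errT: "?err x \<in> fvec T" if "x \<in> fvec S" for x
      using is_op_fvec[OF u(1) that] yT by (auto simp: u'_def fvec_def)
    have err: "q (?err x) \<le> (\<Sum>k\<in>A. bV k * (\<Sum>\<beta>\<in>G. cmod (D k x \<beta>))) * \<delta>" if x: "x \<in> fvec S" for x
    proof -
      have DG: "D k x \<in> fvec G" if "k \<in> A" for k using D[OF that] x by (rule is_op_fvec)
      define h where "h k = (\<lambda>\<phi>. if \<phi> \<in> ?K then r \<phi> (D k x) else 0)" for k
      define d where "d k = (\<lambda>\<phi>. dual_emb G pG (D k x) \<phi> - h k \<phi>)" for k
      have hl: "h k \<in> linf ?K" if "k \<in> A" for k
        using dual_ballD(2)[OF r(1) DG[OF that]] by (intro linfI[of _ _ "pG (D k x)"]) (auto simp: h_def)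
      have dl: "d k \<in> linf ?K" and Vd: "V k (d k) = (\<lambda>b. V k (dual_emb G pG (D k x)) b - V k (h k) b)" if k: "k \<in> A" for k
        unfolding d_def
        using lin_on_diff[OF csubspace_linf Vlin[OF k] G.dual_emb_linf[OF DG[OF k]] hl[OF k]] by auto
      have "u' x b = (\<Sum>k\<in>A. V k (h k) b)" for b
      proof -
        have "u' x b = (\<Sum>k\<in>A. \<Sum>l\<in>r ` ?K. l (D k x) * V k (\<kappa> l) b)"
          by (simp add: u'_def f_def y_def sum.cartesian_product split_def)
        also have "\<dots> = (\<Sum>k\<in>A. V k (h k) b)"
          using fun_cong[OF V\<kappa>, of _ "\<lambda>l. l (D _ x)" b] by (intro sum.cong) (auto simp: h_def)
        finally show ?thesis .
      qed
      then have "?err x = (\<lambda>b. \<Sum>k\<in>A. 1 * V k (d k) b)"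
        using uV[OF x] by (simp add: Vd sum_subtractf)
      then have "q (?err x) \<le> (\<Sum>k\<in>A. cmod 1 * q (V k (d k)))"
        using T.norm_sum[OF A, of "\<lambda>k. V k (d k)" "\<lambda>_. 1"] VT dl by simp
      also have "\<dots> \<le> (\<Sum>k\<in>A. bV k * ((\<Sum>\<beta>\<in>G. cmod (D k x \<beta>)) * \<delta>))"
      proof (rule sum_mono)
        fix k assume k: "k \<in> A"
        have "q (V k (d k)) \<le> bV k * ((\<Sum>\<beta>\<in>G. cmod (D k x \<beta>)) * \<delta>)"
          by (rule Vn[OF k dl[OF k]]) (use r(3)[OF _ DG[OF k]] in \<open>auto simp: d_def h_def dual_emb_def\<close>)
        then show "cmod 1 * q (V k (d k)) \<le> bV k * ((\<Sum>\<beta>\<in>G. cmod (D k x \<beta>)) * \<delta>)" by simp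
      qed
      finally show ?thesis by (simp add: sum_distrib_right mult.assoc)
    qed
    show ?thesis
    \<comment> \<open>Smallness of the error in norm does not by itself bound a factorization.
      Factoring along the coordinates of \<open>S\<close> loses a constant, which \<delta> already
      takes into account through \<open>W\<close>.\<close>
    proof (rule l1_factorI[of S _ "\<lambda>\<alpha> x. x \<alpha>" "\<lambda>\<alpha>. ?err (unitv \<alpha>)"])
      fix x assume x: "x \<in> fvec S"
      have 1: "u x = (\<lambda>b. \<Sum>\<alpha>\<in>S. x \<alpha> * u (unitv \<alpha>) b)"
        using is_op_sum[OF u(1) S.fin, of unitv x] fvec_expand[OF S.fin x] by simp
      have "f i x = (\<Sum>\<alpha>\<in>S. x \<alpha> * f i (unitv \<alpha>))" if "i \<in> ?I" for i
        using lin_functional_sum[OF flin[OF that] S.fin, of unitv x] fvec_expand[OF S.fin x] by simp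
      then have "u' x b = (\<Sum>i\<in>?I. \<Sum>\<alpha>\<in>S. x \<alpha> * f i (unitv \<alpha>) * y i b)" for b
        unfolding u'_def by (intro sum.cong) (auto simp: sum_distrib_right)
      then have 2: "u' x b = (\<Sum>\<alpha>\<in>S. x \<alpha> * u' (unitv \<alpha>) b)" for b
        unfolding u'_def by (subst (asm) sum.swap) (simp add: sum_distrib_left mult.assoc)
      show "?err x = (\<lambda>b. \<Sum>\<alpha>\<in>S. x \<alpha> * ?err (unitv \<alpha>) b)"
        by (subst 1, subst 2) (simp add: right_diff_distrib sum_subtractf)
      have "(\<Sum>\<alpha>\<in>S. cmod (x \<alpha>) * q (?err (unitv \<alpha>)))
        \<le> (\<Sum>\<alpha>\<in>S. (B0 * p x) * ((\<Sum>k\<in>A. bV k * (\<Sum>\<beta>\<in>G. cmod (D k (unitv \<alpha>) \<beta>))) * \<delta>))"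
        using B0 x S.nonneg[OF x] err errT T.nonneg by (intro sum_mono mult_mono) auto
      also have "\<dots> = W * \<delta> * p x" by (simp add: W_def sum_distrib_left sum_distrib_right mult_ac)
      also have "\<dots> \<le> \<epsilon> * p x" using \<delta>(2) S.nonneg[OF x] by (rule mult_right_mono)
      finally show "(\<Sum>\<alpha>\<in>S. cmod (x \<alpha>) * q (?err (unitv \<alpha>))) \<le> \<epsilon> * p x" .
    qed (use S.fin errT in \<open>auto simp: lin_functional_def\<close>)
  qed
  ultimately have "l1_factor S p T q (\<lambda>x b. u' x b + (u x b - u' x b)) (B * C + \<epsilon>)" by (rule l1_factor_add)
  then show ?thesis by simp
qed

subsection \<open>Polynomials on a Banach lattice\<close>

definition peval :: "('n::finite \<Rightarrow> nat) set \<Rightarrow> (('n \<Rightarrow> nat) \<Rightarrow> complex) \<Rightarrow> ('n \<Rightarrow> complex) \<Rightarrow> complex" where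
  "peval J c z = (\<Sum>\<alpha>\<in>J. c \<alpha> * monom z \<alpha>)"

lemma poly_norm_peval: "poly_norm N J c = Sup {cmod (peval J c z) | z. N z \<le> 1}"
  by (simp add: poly_norm_def peval_def)

lemma peval_add: "peval J (\<lambda>\<alpha>. c \<alpha> + d \<alpha>) z = peval J c z + peval J d z"
  and peval_smult: "peval J (\<lambda>\<alpha>. t * c \<alpha>) z = t * peval J c z"
  by (simp_all add: peval_def algebra_simps sum.distrib sum_distrib_left)

lemma peval_sum: "peval J (\<lambda>\<alpha>. \<Sum>k\<in>A. c k \<alpha>) z = (\<Sum>k\<in>A. peval J (c k) z)"
  by (simp add: peval_def sum_distrib_right) (rule sum.swap)

lemma peval_superset:
  assumes "finite J'" "J \<subseteq> J'" "c \<in> fvec J"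
  shows "peval J' c = peval J c"
  using assms unfolding peval_def by (intro ext sum.mono_neutral_right) (auto simp: fvec_def)

lemma monom_smult: "monom (\<lambda>i. t * z i) \<alpha> = t ^ order \<alpha> * monom z \<alpha>"
  by (simp add: Defs.monom_def Defs.order_def power_mult_distrib prod.distrib power_sum)

lemma peval_homogeneous: "J \<subseteq> Lambda m \<Longrightarrow> peval J c (\<lambda>i. t * z i) = t ^ m * peval J c z"
  unfolding peval_def sum_distrib_left
  by (intro sum.cong) (auto simp: monom_smult Lambda_def subset_iff)

section \<open>Raising and lowering an exponent, partial derivatives and Euler's identity\<close>

lemma order_upd: "order (\<alpha>(k := j)) + \<alpha> k = order \<alpha> + j"
  using sum.remove[of UNIV k "\<alpha>(k := j)"] sum.remove[of UNIV k \<alpha>]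
  by (simp add: Defs.order_def cong: sum.cong_simp)

lemma monom_upd: "monom z (\<alpha>(k := j)) = z k ^ j * (\<Prod>i\<in>UNIV - {k}. z i ^ \<alpha> i)"
  using prod.remove[of UNIV k "\<lambda>i. z i ^ (\<alpha>(k := j)) i"]
  by (simp add: Defs.monom_def cong: prod.cong_simp)

lemma monom_up: "monom z (\<alpha>(k := \<alpha> k + 1)) = z k * monom z \<alpha>"
  using monom_upd[of z \<alpha> k "\<alpha> k + 1"] monom_upd[of z \<alpha> k "\<alpha> k"] by simp

lemma finite_order_le: "finite {\<alpha> :: 'n::finite \<Rightarrow> nat. order \<alpha> \<le> m}"
proof (rule finite_subset)
  have "\<alpha> i \<le> order \<alpha>" for \<alpha> :: "'n \<Rightarrow> nat" and i
    unfolding Defs.order_def by (rule member_le_sum) auto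
  then show "{\<alpha> :: 'n \<Rightarrow> nat. order \<alpha> \<le> m} \<subseteq> {f. \<forall>x. (x \<in> UNIV \<longrightarrow> f x \<in> {..m}) \<and> (x \<notin> UNIV \<longrightarrow> f x = 0)}"
    using order_trans by fastforce
  show "finite {f :: 'n \<Rightarrow> nat. \<forall>x. (x \<in> UNIV \<longrightarrow> f x \<in> {..m}) \<and> (x \<notin> UNIV \<longrightarrow> f x = 0)}"
    by (rule finite_set_of_finite_funs) auto
qed

lemma finite_Lambda: "finite (Lambda m :: ('n::finite \<Rightarrow> nat) set)"
  by (rule finite_subset[OF _ finite_order_le[of m]]) (auto simp: Lambda_def)

text \<open>Raising the exponent \<open>k\<close> is a bijection onto the elements of
  \<open>J\<close> with positive exponent \<open>k\<close>. The condition on the left is there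
  because an element of \<open>flat m J\<close> may owe its membership to a different
  variable.\<close>

lemma sum_flat:
  assumes "J \<subseteq> Lambda m" "1 \<le> m"
  shows "(\<Sum>\<beta>\<in>flat m J. if \<beta>(k := \<beta> k + 1) \<in> J then g (\<beta>(k := \<beta> k + 1)) else 0)
    = (\<Sum>\<alpha>\<in>J. if \<alpha> k > 0 then g \<alpha> else (0 :: complex))"
proof -
  have fJ: "finite J" by (rule finite_subset[OF assms(1) finite_Lambda])
  have ff: "finite (flat m J)"
    by (rule finite_subset[OF _ finite_Lambda[of "m - 1"]]) (auto simp: flat_def)
  have "(\<Sum>\<beta>\<in>flat m J. if \<beta>(k := \<beta> k + 1) \<in> J then g (\<beta>(k := \<beta> k + 1)) else 0)
    = (\<Sum>\<beta>\<in>{\<beta>\<in>flat m J. \<beta>(k := \<beta> k + 1) \<in> J}. g (\<beta>(k := \<beta> k + 1)))"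
    by (rule sum.inter_filter[OF ff, symmetric])
  also have "\<dots> = (\<Sum>\<alpha>\<in>{\<alpha>\<in>J. \<alpha> k > 0}. g \<alpha>)"
  proof (rule sum.reindex_bij_witness[of _ "\<lambda>\<alpha>. \<alpha>(k := \<alpha> k - 1)" "\<lambda>\<beta>. \<beta>(k := \<beta> k + 1)"])
    fix \<alpha> assume "\<alpha> \<in> {\<alpha>\<in>J. \<alpha> k > 0}"
    then have \<alpha>: "\<alpha> \<in> J" "\<alpha> k > 0" by auto
    show up: "(\<alpha>(k := \<alpha> k - 1))(k := (\<alpha>(k := \<alpha> k - 1)) k + 1) = \<alpha>" using \<alpha>(2) by (auto simp: fun_eq_iff)
    have "order (\<alpha>(k := \<alpha> k - 1)) = m - 1"
      using order_upd[of \<alpha> k "\<alpha> k - 1"] \<alpha> assms(1) by (auto simp: Lambda_def subset_iff)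
    then show "\<alpha>(k := \<alpha> k - 1) \<in> {\<beta>\<in>flat m J. \<beta>(k := \<beta> k + 1) \<in> J}"
      using up \<alpha>(1) unfolding flat_def Lambda_def mem_Collect_eq by metis
  qed auto
  also have "\<dots> = (\<Sum>\<alpha>\<in>J. if \<alpha> k > 0 then g \<alpha> else 0)"
    by (rule sum.inter_filter[OF fJ])
  finally show ?thesis .
qed

lemma flat_Lambda:
  assumes "1 \<le> m"
  shows "flat m (Lambda m :: ('n::finite \<Rightarrow> nat) set) = Lambda (m - 1)"
proof -
  have "order (\<alpha>(k := \<alpha> k + 1)) = m" if "order \<alpha> = m - 1" for \<alpha> :: "'n \<Rightarrow> nat" and k
    using order_upd[of \<alpha> k "\<alpha> k + 1"] that assms by simp
  then show ?thesis by (auto simp: flat_def Lambda_def)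
qed

text \<open>The guard \<open>\<alpha> k > 0\<close> matters: truncated subtraction would otherwise
  return \<alpha> itself when the exponent is zero.\<close>

definition zmult :: "'n::finite \<Rightarrow> (('n \<Rightarrow> nat) \<Rightarrow> complex) \<Rightarrow> ('n \<Rightarrow> nat) \<Rightarrow> complex" where
  "zmult k d = (\<lambda>\<alpha>. if \<alpha> k > 0 then d (\<alpha>(k := \<alpha> k - 1)) else 0)"

text \<open>\<open>partial m J k\<close> is \<open>1/m\<close> times the \<open>k\<close>-th partial derivative; with this normalization Euler's
  identity reads \<open>\<Sum>k. z\<^sub>k \<sqdot> partial m J k c = c\<close>.\<close>

definition partial :: "nat \<Rightarrow> ('n::finite \<Rightarrow> nat) set \<Rightarrow> 'n \<Rightarrow> (('n \<Rightarrow> nat) \<Rightarrow> complex) \<Rightarrow> ('n \<Rightarrow> nat) \<Rightarrow> complex" where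
  "partial m J k c = (\<lambda>\<beta>. if \<beta> \<in> flat m J then of_nat (\<beta> k + 1) / of_nat m * c (\<beta>(k := \<beta> k + 1)) else 0)"

lemma zmult_fvec:
  assumes "d \<in> fvec G" "G \<subseteq> Lambda (m - 1)" "1 \<le> m"
  shows "zmult k d \<in> fvec (Lambda m)"
proof -
  have "\<alpha> \<in> Lambda m" if "\<alpha> k > 0" "\<alpha>(k := \<alpha> k - 1) \<in> G" for \<alpha>
  proof -
    have "order (\<alpha>(k := \<alpha> k - 1)) = m - 1" using that(2) assms(2) by (auto simp: Lambda_def)
    then show ?thesis using order_upd[of \<alpha> k "\<alpha> k - 1"] that(1) assms(3) by (simp add: Lambda_def)
  qed
  then show ?thesis using assms(1) by (auto simp: zmult_def fvec_def)
qed

text \<open>The product is taken in all of \<open>Lambda m\<close>, since multiplying a polynomial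
  over \<open>flat m J\<close> by a variable may leave \<open>J\<close>. Returning to
  \<open>J\<close> is what costs the norm of \<open>Qmap\<close>.\<close>

lemma peval_zmult:
  assumes "d \<in> fvec G" "G \<subseteq> Lambda (m - 1)" "1 \<le> m"
  shows "peval (Lambda m) (zmult k d) z = z k * peval G d z"
proof -
  have up: "\<beta>(k := \<beta> k + 1) \<in> Lambda m" if "\<beta> \<in> Lambda (m - 1)" for \<beta>
    using order_upd[of \<beta> k "\<beta> k + 1"] that assms(3) by (simp add: Lambda_def)
  have "peval (Lambda m) (zmult k d) z = (\<Sum>\<alpha>\<in>Lambda m. if \<alpha> k > 0 then d (\<alpha>(k := \<alpha> k - 1)) * monom z \<alpha> else 0)"
    unfolding peval_def by (intro sum.cong) (auto simp: zmult_def)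
  also have "\<dots> = (\<Sum>\<beta>\<in>flat m (Lambda m). if \<beta>(k := \<beta> k + 1) \<in> Lambda m
      then d ((\<beta>(k := \<beta> k + 1))(k := (\<beta>(k := \<beta> k + 1)) k - 1)) * monom z (\<beta>(k := \<beta> k + 1)) else 0)"
    by (rule sum_flat[symmetric]) (use assms(3) in auto)
  also have "\<dots> = (\<Sum>\<beta>\<in>Lambda (m - 1). d \<beta> * monom z (\<beta>(k := \<beta> k + 1)))"
    unfolding flat_Lambda[OF assms(3)] using up by (intro sum.cong) auto
  also have "\<dots> = z k * peval (Lambda (m - 1)) d z"
    by (simp add: peval_def sum_distrib_left monom_up[simplified] mult_ac)
  finally show ?thesis using peval_superset[OF finite_Lambda assms(2,1)] by simp
qed

lemma is_op_Qmap: "is_op J I (Qmap I)"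
  by (auto simp: is_op_def Qmap_def fvec_def fun_eq_iff)

lemma Qmap_id: "c \<in> fvec I \<Longrightarrow> Qmap I c = c"
  by (auto simp: Qmap_def fvec_def fun_eq_iff)

lemma is_op_partial: "is_op J (flat m J) (partial m J k)"
  by (auto simp: is_op_def partial_def fvec_def fun_eq_iff algebra_simps)

lemma is_op_zmult: "is_op G J (\<lambda>d. Qmap J (zmult k d))"
  by (auto simp: is_op_def Qmap_def zmult_def fvec_def fun_eq_iff)

text \<open>The k-th summand multiplies the coefficient at \<alpha> by \<alpha> k / m, and these
  weights add up to order \<alpha> / m = 1.\<close>

lemma euler:
  assumes "J \<subseteq> Lambda m" "1 \<le> m" "c \<in> fvec J"
  shows "(\<lambda>\<alpha>. \<Sum>k\<in>UNIV. Qmap J (zmult k (partial m J k c)) \<alpha>) = c"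
proof
  fix \<alpha>
  show "(\<Sum>k\<in>UNIV. Qmap J (zmult k (partial m J k c)) \<alpha>) = c \<alpha>"
  proof (cases "\<alpha> \<in> J")
    case False
    then show ?thesis using assms(3) by (simp add: Qmap_def fvec_def)
  next
    case True
    have o: "order \<alpha> = m" using True assms(1) by (auto simp: Lambda_def)
    have "Qmap J (zmult k (partial m J k c)) \<alpha> = of_nat (\<alpha> k) / of_nat m * c \<alpha>" for k
    proof (cases "\<alpha> k > 0")
      case pos: True
      have up: "(\<alpha>(k := \<alpha> k - 1))(k := (\<alpha>(k := \<alpha> k - 1)) k + 1) = \<alpha>" using pos by (auto simp: fun_eq_iff)
      have "order (\<alpha>(k := \<alpha> k - 1)) = m - 1" using order_upd[of \<alpha> k "\<alpha> k - 1"] pos o by simp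
      then have fl: "\<alpha>(k := \<alpha> k - 1) \<in> flat m J"
        using up True unfolding flat_def Lambda_def mem_Collect_eq by metis
      have "partial m J k c (\<alpha>(k := \<alpha> k - 1)) = of_nat (\<alpha> k - 1 + 1) / of_nat m * c \<alpha>"
        unfolding partial_def up using fl by simp
      then show ?thesis using True pos by (simp add: Qmap_def zmult_def)
    qed (use True in \<open>simp add: Qmap_def zmult_def\<close>)
    then have "(\<Sum>k\<in>UNIV. Qmap J (zmult k (partial m J k c)) \<alpha>) = of_nat (order \<alpha>) / of_nat m * c \<alpha>"
      by (simp add: Defs.order_def sum_distrib_right sum_divide_distrib)
    then show ?thesis using o assms(2) by simp
  qed
qed

text \<open>The product rule, monomial by monomial; where the exponent \<open>\<alpha> k - 1\<close>
  is truncated, the factor \<open>of_nat (\<alpha> k)\<close> is zero. The factor \<open>m\<close>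
  undoes the normalization of \<open>partial\<close>.\<close>

lemma peval_has_derivative:
  assumes "J \<subseteq> Lambda m" "1 \<le> m" "c \<in> fvec J"
  shows "((\<lambda>t. peval J c (\<lambda>i. z i + t * w i)) has_field_derivative
    of_nat m * (\<Sum>k\<in>UNIV. w k * peval (flat m J) (partial m J k c) z)) (at 0)"
proof -
  have "((\<lambda>t. peval J c (\<lambda>i. z i + t * w i)) has_field_derivative
     (\<Sum>\<alpha>\<in>J. c \<alpha> * (\<Sum>k\<in>UNIV. (of_nat (\<alpha> k) * z k ^ (\<alpha> k - 1) * w k) * (\<Prod>i\<in>UNIV - {k}. z i ^ \<alpha> i)))) (at 0)"
    unfolding peval_def Defs.monom_def
  proof (intro DERIV_sum DERIV_cmult)
    fix \<alpha> assume "\<alpha> \<in> J"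
    have "((\<lambda>t. \<Prod>i\<in>UNIV. (z i + t * w i) ^ \<alpha> i) has_field_derivative
       (\<Sum>k\<in>UNIV. (of_nat (\<alpha> k) * z k ^ (\<alpha> k - 1) * w k) * (\<Prod>i\<in>UNIV - {k}. (z i + 0 * w i) ^ \<alpha> i))) (at 0)"
      by (rule has_field_derivative_prod) (auto intro!: derivative_eq_intros)
    then show "((\<lambda>t. \<Prod>i\<in>UNIV. (z i + t * w i) ^ \<alpha> i) has_field_derivative
       (\<Sum>k\<in>UNIV. (of_nat (\<alpha> k) * z k ^ (\<alpha> k - 1) * w k) * (\<Prod>i\<in>UNIV - {k}. z i ^ \<alpha> i))) (at 0)" by simp
  qed
  moreover have "(\<Sum>\<alpha>\<in>J. c \<alpha> * (\<Sum>k\<in>UNIV. (of_nat (\<alpha> k) * z k ^ (\<alpha> k - 1) * w k) * (\<Prod>i\<in>UNIV - {k}. z i ^ \<alpha> i)))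
    = of_nat m * (\<Sum>k\<in>UNIV. w k * peval (flat m J) (partial m J k c) z)"
  proof -
    have k: "of_nat m * peval (flat m J) (partial m J k c) z
      = (\<Sum>\<alpha>\<in>J. of_nat (\<alpha> k) * c \<alpha> * monom z (\<alpha>(k := \<alpha> k - 1)))" for k
    proof -
      have "of_nat m * peval (flat m J) (partial m J k c) z
        = (\<Sum>\<beta>\<in>flat m J. if \<beta>(k := \<beta> k + 1) \<in> J then of_nat (\<beta> k + 1) * c (\<beta>(k := \<beta> k + 1)) * monom z \<beta> else 0)"
        unfolding peval_def sum_distrib_left using assms(2,3)
        by (intro sum.cong) (auto simp: partial_def fvec_def)
      also have "\<dots> = (\<Sum>\<alpha>\<in>J. if \<alpha> k > 0 then of_nat (\<alpha> k) * c \<alpha> * monom z (\<alpha>(k := \<alpha> k - 1)) else 0)"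
        using sum_flat[OF assms(1,2), of k "\<lambda>\<alpha>. of_nat (\<alpha> k) * c \<alpha> * monom z (\<alpha>(k := \<alpha> k - 1))"]
        by (simp cong: if_cong)
      also have "\<dots> = (\<Sum>\<alpha>\<in>J. of_nat (\<alpha> k) * c \<alpha> * monom z (\<alpha>(k := \<alpha> k - 1)))"
        by (intro sum.cong) auto
      finally show ?thesis .
    qed
    have "of_nat m * (\<Sum>k\<in>UNIV. w k * peval (flat m J) (partial m J k c) z)
      = (\<Sum>k\<in>UNIV. w k * (of_nat m * peval (flat m J) (partial m J k c) z))"
      by (simp add: sum_distrib_left mult_ac)
    also have "\<dots> = (\<Sum>k\<in>UNIV. \<Sum>\<alpha>\<in>J. w k * (of_nat (\<alpha> k) * c \<alpha> * monom z (\<alpha>(k := \<alpha> k - 1))))"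
      by (simp add: k sum_distrib_left)
    also have "\<dots> = (\<Sum>\<alpha>\<in>J. \<Sum>k\<in>UNIV. w k * (of_nat (\<alpha> k) * c \<alpha> * monom z (\<alpha>(k := \<alpha> k - 1))))"
      by (rule sum.swap)
    finally show ?thesis by (simp add: sum_distrib_left monom_upd mult_ac)
  qed
  ultimately show ?thesis by simp
qed

text \<open>A geometric sum whose ratio is an n-th root of unity, equal to 1 exactly if n divides
  e.\<close>

lemma sum_root_unity_powers:
  fixes n e :: nat
  assumes "0 < n"
  shows "(\<Sum>j<n. cis (2 * pi / n) ^ (j * e)) = (if n dvd e then of_nat n else 0)"
proof -
  let ?x = "cis (2 * pi / n) ^ e"
  have x: "?x = exp (2 * of_real pi * \<i> * of_nat e / of_nat n)"
    unfolding Complex.DeMoivre unfolding cis_conv_exp by (rule arg_cong[of _ _ exp]) simp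
  have "?x ^ n = 1"
    unfolding x by (rule complex_root_unity) (use assms in simp)
  moreover have "?x = 1 \<longleftrightarrow> n dvd e"
    unfolding x using complex_root_unity_eq_1[of n e] assms by simp
  ultimately show ?thesis
    using sum_gp_strict[of ?x n] by (simp add: power_mult mult.commute[of _ e])
qed


section \<open>Polynomial norms on the unit ball of the lattice\<close>

locale lattice_norm =
  fixes N :: "('n::finite \<Rightarrow> complex) \<Rightarrow> real"
  assumes lattice: "banach_lattice N"
begin

lemma N_nonneg: "0 \<le> N z"
  and N_eq_0: "N z = 0 \<longleftrightarrow> z = (\<lambda>_. 0)"
  and N_hom: "N (\<lambda>i. c * z i) = cmod c * N z"
  and N_tri: "N (\<lambda>i. z i + w i) \<le> N z + N w"
  and N_mono: "(\<And>k. cmod (z k) \<le> cmod (w k)) \<Longrightarrow> N z \<le> N w"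
  using lattice unfolding banach_lattice_def by blast+

lemma N_zero: "N (\<lambda>_. 0) = 0"
  by (simp add: N_eq_0)

text \<open>By the lattice property, deleting all coordinates of \<open>z\<close> but the i-th does
  not increase the norm.\<close>

lemma coordinates_bounded:
  obtains R where "\<And>z i. N z \<le> 1 \<Longrightarrow> cmod (z i) \<le> R i"
proof -
  have "cmod (z i) \<le> 1 / N (unitv i)" if "N z \<le> 1" for z i
  proof -
    have "N (unitv i) \<noteq> 0" by (auto simp: N_eq_0 unitv_def fun_eq_iff)
    then have pos: "N (unitv i) > 0" using N_nonneg[of "unitv i"] by linarith
    have "cmod (z i) * N (unitv i) = N (\<lambda>j. z i * unitv i j)" by (simp add: N_hom)
    also have "\<dots> \<le> N z" by (rule N_mono) (auto simp: unitv_def)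
    finally show ?thesis using that pos by (simp add: pos_le_divide_eq)
  qed
  then show ?thesis by (rule that)
qed

lemma peval_bdd: "bdd_above {cmod (peval J c z) | z. N z \<le> 1}"
proof -
  obtain R where R: "\<And>z i. N z \<le> 1 \<Longrightarrow> cmod (z i) \<le> R i" by (rule coordinates_bounded) blast
  show ?thesis
  proof (rule bdd_aboveI[of _ "\<Sum>\<alpha>\<in>J. cmod (c \<alpha>) * (\<Prod>i\<in>UNIV. R i ^ \<alpha> i)"])
    fix y assume "y \<in> {cmod (peval J c z) | z. N z \<le> 1}"
    then obtain z where z: "y = cmod (peval J c z)" "N z \<le> 1" by blast
    have m: "cmod (monom z \<alpha>) \<le> (\<Prod>i\<in>UNIV. R i ^ \<alpha> i)" for \<alpha>
      unfolding Defs.monom_def prod_norm[symmetric] norm_power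
      by (intro prod_mono conjI power_mono R z(2)) auto
    show "y \<le> (\<Sum>\<alpha>\<in>J. cmod (c \<alpha>) * (\<Prod>i\<in>UNIV. R i ^ \<alpha> i))"
      unfolding z(1) peval_def using m by (intro sum_norm_le) (auto simp: norm_mult intro!: mult_left_mono)
  qed
qed

lemma poly_norm_upper: "N z \<le> 1 \<Longrightarrow> cmod (peval J c z) \<le> poly_norm N J c"
  unfolding poly_norm_peval by (rule cSup_upper[OF _ peval_bdd]) auto

lemma poly_norm_least: "(\<And>z. N z \<le> 1 \<Longrightarrow> cmod (peval J c z) \<le> M) \<Longrightarrow> poly_norm N J c \<le> M"
  unfolding poly_norm_peval using N_zero by (intro cSup_least) (auto intro: exI[of _ "\<lambda>_. 0"])

lemma poly_norm_nonneg: "0 \<le> poly_norm N J c"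
  using order_trans[OF norm_ge_zero poly_norm_upper[of "\<lambda>_. 0"]] by (simp add: N_zero)

text \<open>Subtracting \<open>2^(- \<beta> i) P(z)\<close> from \<open>P\<close> with the \<open>i\<close>-th variable halved removes the monomial \<open>\<beta>\<close> but not
  \<open>\<alpha>\<close> if \<open>\<beta> i \<noteq> \<alpha> i\<close>, and the lattice property keeps the halved point in the unit ball.\<close>

lemma coefficient_bounded:
  assumes "finite F" "\<alpha> \<notin> F"
  shows "\<exists>B. \<forall>c M. (\<forall>z. N z \<le> 1 \<longrightarrow> cmod (peval (insert \<alpha> F) c z) \<le> M) \<longrightarrow> cmod (c \<alpha>) \<le> B * M"
  using assms
proof (induction F rule: finite_induct)
  case empty
  \<comment> \<open>A constant point of norm 1: all of its coordinates are nonzero, so no monomial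
    vanishes there. The factor \<open>* 1\<close> puts it in the form to which \<open>N_hom\<close>
    applies.\<close>
  define z :: "'n \<Rightarrow> complex" where "z = (\<lambda>i. complex_of_real (1 / N (\<lambda>_. 1)) * 1)"
  have "N (\<lambda>_. 1) \<noteq> 0" by (auto simp: N_eq_0 fun_eq_iff)
  then have pos: "N (\<lambda>_. 1) > 0" using N_nonneg[of "\<lambda>_. 1"] by linarith
  have "N z \<le> 1" unfolding z_def N_hom using pos by (simp add: norm_divide)
  have mz: "monom z \<alpha> \<noteq> 0" using pos by (simp add: Defs.monom_def z_def)
  have "cmod (c \<alpha>) \<le> (1 / cmod (monom z \<alpha>)) * M"
    if "\<forall>z. N z \<le> 1 \<longrightarrow> cmod (peval {\<alpha>} c z) \<le> M" for c M
    using that[rule_format, OF \<open>N z \<le> 1\<close>] mz by (simp add: peval_def norm_mult pos_le_divide_eq)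
  then show ?case by blast
next
  case (insert \<beta> F)
  then obtain B where B: "\<And>c M. (\<forall>z. N z \<le> 1 \<longrightarrow> cmod (peval (insert \<alpha> F) c z) \<le> M) \<Longrightarrow> cmod (c \<alpha>) \<le> B * M"
    by auto
  have "\<alpha> \<noteq> \<beta>" using insert.prems by auto
  then obtain i where i: "\<alpha> i \<noteq> \<beta> i" by (auto simp: fun_eq_iff)
  define s :: "nat \<Rightarrow> complex" where "s j = (1/2) ^ j" for j
  have s: "cmod (s j) \<le> 1" for j by (simp add: s_def norm_power norm_divide power_le_one)
  have "s (\<alpha> i) \<noteq> s (\<beta> i)"
  proof
    assume "s (\<alpha> i) = s (\<beta> i)"
    then have "cmod (s (\<alpha> i)) = cmod (s (\<beta> i))" by simp
    then show False using i power_inject_exp'[of "1/2::real" "\<alpha> i" "\<beta> i"] by (simp add: s_def norm_power norm_divide)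
  qed
  then have d0: "cmod (s (\<alpha> i) - s (\<beta> i)) > 0" by simp
  have "cmod (c \<alpha>) \<le> (B * 2 / cmod (s (\<alpha> i) - s (\<beta> i))) * M"
    if M: "\<forall>z. N z \<le> 1 \<longrightarrow> cmod (peval (insert \<alpha> (insert \<beta> F)) c z) \<le> M" for c M
  proof -
    define c' where "c' \<gamma> = c \<gamma> * (s (\<gamma> i) - s (\<beta> i))" for \<gamma>
    have "cmod (peval (insert \<alpha> F) c' z) \<le> 2 * M" if z: "N z \<le> 1" for z
    proof -
      let ?z = "z(i := 1/2 * z i)"
      have "monom ?z \<gamma> = s (\<gamma> i) * monom z \<gamma>" for \<gamma>
      proof -
        have "monom ?z \<gamma> = (1/2 * z i) ^ \<gamma> i * (\<Prod>j\<in>UNIV - {i}. z j ^ \<gamma> j)"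
          unfolding Defs.monom_def by (subst prod.remove[of _ i]) auto
        also have "\<dots> = s (\<gamma> i) * (z i ^ \<gamma> i * (\<Prod>j\<in>UNIV - {i}. z j ^ \<gamma> j))"
          by (simp add: s_def power_mult_distrib power_divide)
        also have "z i ^ \<gamma> i * (\<Prod>j\<in>UNIV - {i}. z j ^ \<gamma> j) = monom z \<gamma>"
          unfolding Defs.monom_def by (subst prod.remove[of UNIV i]) auto
        finally show ?thesis .
      qed
      then have "peval (insert \<alpha> F) c' z = peval (insert \<alpha> (insert \<beta> F)) c ?z - s (\<beta> i) * peval (insert \<alpha> (insert \<beta> F)) c z"
        using insert.hyps insert.prems \<open>\<alpha> \<noteq> \<beta>\<close>
        by (simp add: peval_def c'_def algebra_simps sum_subtractf sum_distrib_left)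
      also have "cmod \<dots> \<le> M + 1 * M"
      proof (intro norm_triangle_le_diff add_mono)
        have "N ?z \<le> N z" by (rule N_mono) (auto simp: norm_divide)
        then show "cmod (peval (insert \<alpha> (insert \<beta> F)) c ?z) \<le> M" using M z by auto
        show "cmod (s (\<beta> i) * peval (insert \<alpha> (insert \<beta> F)) c z) \<le> 1 * M"
          unfolding norm_mult using M z s by (intro mult_mono) auto
      qed
      finally show ?thesis by simp
    qed
    then have "cmod (c' \<alpha>) \<le> B * (2 * M)" using B by blast
    then show ?thesis using d0 by (simp add: c'_def norm_mult pos_le_divide_eq mult_ac)
  qed
  then show ?case by blast
qed

lemma coord_normed_poly:
  assumes "finite J"
  shows "coord_normed J (poly_norm N J)"
proof
  show "poly_norm N J (\<lambda>a. x a + y a) \<le> poly_norm N J x + poly_norm N J y" for x y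
    by (rule poly_norm_least) (auto simp: peval_add intro!: norm_triangle_le add_mono poly_norm_upper)
  have le: "poly_norm N J (\<lambda>a. c * x a) \<le> cmod c * poly_norm N J x" for c x
    by (rule poly_norm_least) (auto simp: peval_smult norm_mult intro!: mult_left_mono poly_norm_upper)
  show "poly_norm N J (\<lambda>a. c * x a) = cmod c * poly_norm N J x" for c x
  proof (cases "c = 0")
    case True
    then show ?thesis using le[of 0 x] poly_norm_nonneg[of J "\<lambda>_. 0"] by simp
  next
    case False
    have "cmod c * poly_norm N J x \<le> cmod c * (cmod (1/c) * poly_norm N J (\<lambda>a. c * x a))"
      using le[of "1/c" "\<lambda>a. c * x a"] False by (intro mult_left_mono) auto
    then show ?thesis using le[of c x] False by (simp add: norm_divide)
  qed
  show "\<exists>B. \<forall>x\<in>fvec J. \<forall>a\<in>J. cmod (x a) \<le> B * poly_norm N J x"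
  proof -
    have "\<exists>B. \<forall>x. cmod (x \<alpha>) \<le> B * poly_norm N J x" if "\<alpha> \<in> J" for \<alpha>
    proof -
      have "insert \<alpha> (J - {\<alpha>}) = J" using that by auto
      then obtain B where "\<forall>c M. (\<forall>z. N z \<le> 1 \<longrightarrow> cmod (peval J c z) \<le> M) \<longrightarrow> cmod (c \<alpha>) \<le> B * M"
        using coefficient_bounded[of "J - {\<alpha>}" \<alpha>] assms by auto
      then show ?thesis using poly_norm_upper by blast
    qed
    then obtain b where b: "\<And>\<alpha> x. \<alpha> \<in> J \<Longrightarrow> cmod (x \<alpha>) \<le> b \<alpha> * poly_norm N J x" by metis
    have "cmod (x \<alpha>) \<le> (\<Sum>\<alpha>\<in>J. \<bar>b \<alpha>\<bar>) * poly_norm N J x" if "\<alpha> \<in> J" for \<alpha> x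
    proof -
      have "b \<alpha> \<le> \<bar>b \<alpha>\<bar>" by simp
      also have "\<dots> \<le> (\<Sum>\<alpha>\<in>J. \<bar>b \<alpha>\<bar>)" using that assms by (intro member_le_sum) auto
      finally have "b \<alpha> * poly_norm N J x \<le> (\<Sum>\<alpha>\<in>J. \<bar>b \<alpha>\<bar>) * poly_norm N J x"
        using poly_norm_nonneg by (intro mult_right_mono)
      then show ?thesis using b[OF that, of x] by linarith
    qed
    then show ?thesis by blast
  qed
qed (use assms poly_norm_nonneg in auto)

lemma poly_norm_superset:
  assumes "finite J'" "J \<subseteq> J'" "c \<in> fvec J"
  shows "poly_norm N J' c = poly_norm N J c"
  using peval_superset[OF assms] by (simp add: poly_norm_peval)

text \<open>Cauchy's estimate for \<open>t \<mapsto> P(z + t w)\<close> on the circle of radius \<open>1/m\<close>.\<close>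

lemma norm_partial_le:
  assumes "J \<subseteq> Lambda m" "1 \<le> m" "c \<in> fvec J" "N z \<le> 1" "N w \<le> 1"
  shows "cmod (\<Sum>k\<in>UNIV. w k * peval (flat m J) (partial m J k c) z) \<le> exp 1 * poly_norm N J c"
proof -
  let ?S = "\<Sum>k\<in>UNIV. w k * peval (flat m J) (partial m J k c) z"
  let ?f = "\<lambda>t. peval J c (\<lambda>i. z i + t * w i)"
  have D: "deriv ?f 0 = of_nat m * ?S"
    by (rule DERIV_imp_deriv[OF peval_has_derivative[OF assms(1-3)]])
  have hol: "?f holomorphic_on A" for A
    unfolding peval_def Defs.monom_def by (intro holomorphic_intros)
  \<comment> \<open>The radius \<open>1 / real m\<close> contributes a factor \<open>m\<close>,
    which cancels against the one in \<open>D\<close>.\<close>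
  have "cmod ((deriv ^^ 1) ?f 0) \<le> fact 1 * (exp 1 * poly_norm N J c) / (1 / real m) ^ 1"
  proof (rule Cauchy_inequality)
    fix t :: complex assume "cmod (0 - t) = 1 / real m"
    then have t: "cmod t = 1 / real m" by simp
    \<comment> \<open>The point z + t w lies in the ball of radius \<open>a\<close>; by homogeneity,
      rescaling it to the unit ball costs \<open>a ^ m\<close>, which is at most
      \<open>exp 1\<close>.\<close>
    define a where "a = 1 + 1 / real m"
    have a: "a > 0" by (simp add: a_def add_pos_nonneg)
    define y where "y = (\<lambda>i. complex_of_real (1 / a) * (z i + t * w i))"
    have "N (\<lambda>i. z i + t * w i) \<le> N z + cmod t * N w" using N_tri[of z "\<lambda>i. t * w i"] by (simp add: N_hom)
    also have "\<dots> \<le> 1 + cmod t * 1" using assms(4,5) by (intro add_mono mult_left_mono) auto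
    finally have "N (\<lambda>i. z i + t * w i) \<le> a" by (simp add: a_def t)
    then have "N y \<le> 1" unfolding y_def N_hom using a by (simp add: norm_divide divide_le_eq)
    have "(\<lambda>i. z i + t * w i) = (\<lambda>i. complex_of_real a * y i)" using a by (auto simp: y_def)
    then have "cmod (?f t) = a ^ m * cmod (peval J c y)"
      using peval_homogeneous[OF assms(1)] a by (simp add: norm_mult norm_power)
    also have "\<dots> \<le> exp 1 * poly_norm N J c"
    proof (rule mult_mono)
      show "a ^ m \<le> exp 1" using exp_ge_one_plus_x_over_n_power_n[of m 1] assms(2) by (simp add: a_def)
    qed (use poly_norm_upper[OF \<open>N y \<le> 1\<close>] in auto)
    finally show "cmod (?f t) \<le> exp 1 * poly_norm N J c" .
  qed (use assms(2) in \<open>auto intro!: hol holomorphic_on_imp_continuous_on\<close>)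
  then have "real m * cmod ?S \<le> real m * (exp 1 * poly_norm N J c)"
    using D assms(2) by (simp add: norm_mult mult_ac)
  then show ?thesis using assms(2) by simp
qed

text \<open>The \<open>k\<close>-homogeneous part is an average of \<open>P(\<omega>\<^sup>j z)\<close>, weighted by powers of a primitive root of unity \<open>\<omega>\<close>.\<close>

lemma poly_norm_homogeneous_part:
  assumes "finite J" "\<And>\<alpha>. \<alpha> \<in> J \<Longrightarrow> order \<alpha> \<le> m" "k \<le> m"
  shows "poly_norm N (Jpart J k) (Qmap (Jpart J k) c) \<le> poly_norm N J c"
proof (rule poly_norm_least)
  fix z assume z: "N z \<le> 1"
  \<comment> \<open>\<open>L\<close> exceeds every order in \<open>J\<close>, so distinct orders are
    distinct modulo \<open>L\<close>. The exponent \<open>L - k\<close> used below represents -k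
    modulo \<open>L\<close> as a natural number.\<close>
  define L where "L = m + 1"
  define \<omega> where "\<omega> = cis (2 * pi / real L)"
  have L: "0 < L" by (simp add: L_def)
  have w: "cmod (\<omega> ^ j) = 1" for j by (simp add: \<omega>_def norm_power)
  have dv: "L dvd order \<alpha> + (L - k) \<longleftrightarrow> order \<alpha> = k" if "\<alpha> \<in> J" for \<alpha>
  proof
    assume "L dvd order \<alpha> + (L - k)"
    then obtain q where q: "order \<alpha> + (L - k) = L * q" by blast
    \<comment> \<open>The exponent lies strictly between 0 and \<open>2 * L\<close>, so
      \<open>L\<close> is the only multiple of \<open>L\<close> that it can equal.\<close>
    have "order \<alpha> + (L - k) < L * 2" "0 < order \<alpha> + (L - k)" using assms(2)[OF that] assms(3) by (auto simp: L_def)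
    then have "q = 1" unfolding q using L by (cases q) auto
    then show "order \<alpha> = k" using q assms(3) by (simp add: L_def)
  qed (use assms(3) in \<open>auto simp: L_def\<close>)
  have "(\<Sum>j<L. \<omega> ^ (j * (L - k)) * peval J c (\<lambda>i. \<omega> ^ j * z i))
    = (\<Sum>j<L. \<Sum>\<alpha>\<in>J. c \<alpha> * monom z \<alpha> * \<omega> ^ (j * (order \<alpha> + (L - k))))"
    unfolding peval_def monom_smult sum_distrib_left
    by (intro sum.cong refl) (simp add: power_add power_mult distrib_left mult_ac)
  also have "\<dots> = (\<Sum>\<alpha>\<in>J. c \<alpha> * monom z \<alpha> * (\<Sum>j<L. \<omega> ^ (j * (order \<alpha> + (L - k)))))"
    by (subst sum.swap) (simp add: sum_distrib_left)
  also have "\<dots> = (\<Sum>\<alpha>\<in>J. if order \<alpha> = k then of_nat L * (c \<alpha> * monom z \<alpha>) else 0)"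
    unfolding \<omega>_def sum_root_unity_powers[OF L] by (intro sum.cong) (auto simp: dv)
  also have "\<dots> = (\<Sum>\<alpha>\<in>Jpart J k. of_nat L * (c \<alpha> * monom z \<alpha>))"
    by (subst sum.inter_filter[OF assms(1), symmetric]) (auto simp: Jpart_def Lambda_def intro!: sum.cong)
  also have "\<dots> = of_nat L * peval (Jpart J k) (Qmap (Jpart J k) c) z"
    by (simp add: peval_def sum_distrib_left Qmap_def)
  finally have "real L * cmod (peval (Jpart J k) (Qmap (Jpart J k) c) z)
    = cmod (\<Sum>j<L. \<omega> ^ (j * (L - k)) * peval J c (\<lambda>i. \<omega> ^ j * z i))"
    by (simp add: norm_mult)
  also have "\<dots> \<le> (\<Sum>j<L. poly_norm N J c)"
    by (intro sum_norm_le) (auto simp: norm_mult w N_hom z intro!: poly_norm_upper)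
  finally show "cmod (peval (Jpart J k) (Qmap (Jpart J k) c) z) \<le> poly_norm N J c"
    using L by simp
qed

end

subsection \<open>The Gordon--Lewis constant\<close>

context lattice_norm
begin

lemma Qnorm_nonneg:
  assumes "J \<subseteq> Lambda m"
  shows "0 \<le> Qnorm N (Lambda m) J"
  unfolding Qnorm_def
  using finite_subset[OF assms finite_Lambda]
  by (intro coord_normed.opnorm_nonneg coord_normed_poly finite_Lambda is_op_Qmap) auto

lemma Qnorm_upper:
  assumes "J \<subseteq> Lambda m" "c \<in> fvec (Lambda m)"
  shows "poly_norm N J (Qmap J c) \<le> Qnorm N (Lambda m) J * poly_norm N (Lambda m) c"
  unfolding Qnorm_def
  using finite_subset[OF assms(1) finite_Lambda] assms(2)
  by (intro coord_normed.opnorm_ge coord_normed_poly finite_Lambda is_op_Qmap) auto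

text \<open>A single monomial from \<open>J\<close> is fixed by the projection and keeps its
  norm.\<close>

lemma Qnorm_ge_1:
  assumes "J \<subseteq> Lambda m" "J \<noteq> {}"
  shows "1 \<le> Qnorm N (Lambda m) J"
proof -
  obtain \<alpha> where \<alpha>: "\<alpha> \<in> J" using assms(2) by blast
  let ?x = "unitv \<alpha> :: ('n \<Rightarrow> nat) \<Rightarrow> complex"
  have x: "?x \<in> fvec J" "?x \<in> fvec (Lambda m)" using \<alpha> assms(1) by auto
  have "?x \<noteq> (\<lambda>_. 0)" by (auto simp: unitv_def fun_eq_iff)
  moreover have "poly_norm N J (Qmap J ?x) = poly_norm N (Lambda m) ?x"
    using poly_norm_superset[OF finite_Lambda assms(1) x(1)] Qmap_id[OF x(1)] by simp
  ultimately show ?thesis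
    unfolding Qnorm_def
    using x(2) finite_subset[OF assms(1) finite_Lambda]
    by (intro coord_normed.opnorm_isometry_ge_1[of _ _ _ _ _ ?x] coord_normed_poly finite_Lambda is_op_Qmap) auto
qed

lemma flat_subset: "flat m J \<subseteq> Lambda (m - 1)"
  by (auto simp: flat_def)

lemma finite_flat: "finite (flat m J)"
  by (rule finite_subset[OF flat_subset finite_Lambda])

lemma flat_nonempty:
  assumes "\<alpha> \<in> J" "order \<alpha> = m" "1 \<le> m"
  shows "flat m J \<noteq> {}"
proof -
  have "\<exists>k. \<alpha> k > 0"
  proof (rule ccontr)
    assume "\<not> ?thesis"
    then have "order \<alpha> = 0" by (simp add: Defs.order_def)
    then show False using assms(2,3) by simp
  qed
  then obtain k where k: "\<alpha> k > 0" by blast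
  have up: "(\<alpha>(k := \<alpha> k - 1))(k := (\<alpha>(k := \<alpha> k - 1)) k + 1) = \<alpha>" using k by (auto simp: fun_eq_iff)
  have "order (\<alpha>(k := \<alpha> k - 1)) = m - 1" using order_upd[of \<alpha> k "\<alpha> k - 1"] k assms(2) by simp
  then have "\<alpha>(k := \<alpha> k - 1) \<in> flat m J"
    using up assms(1) unfolding flat_def Lambda_def mem_Collect_eq by metis
  then show ?thesis by blast
qed

lemma lambda_poly_nonneg: "0 \<le> lambda_poly N (flat m J)"
  unfolding lambda_poly_def by (rule coord_normed.proj_const_nonneg[OF coord_normed_poly[OF finite_flat]])

text \<open>Estimating each \<open>P (g k)\<close> separately would bring in the number of
  variables. Instead the sum is evaluated at one point of the unit ball, where it is the value of
  \<open>P\<close> at a single bounded function.\<close>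

lemma zmult_projection_bound:
  assumes "J \<subseteq> Lambda m" "1 \<le> m" "c \<in> fvec J"
    and P: "is_projection (flat m J) (poly_norm N (flat m J)) P"
    and g: "\<And>k. g k \<in> linf (dual_ball (flat m J) (poly_norm N (flat m J)))"
    and r: "\<And>\<phi>. \<phi> \<in> dual_ball (flat m J) (poly_norm N (flat m J)) \<Longrightarrow>
      r \<phi> \<in> dual_ball (flat m J) (poly_norm N (flat m J))"
    and gr: "\<And>k \<phi>. \<phi> \<in> dual_ball (flat m J) (poly_norm N (flat m J)) \<Longrightarrow>
      cmod (g k \<phi>) \<le> cmod (r \<phi> (partial m J k c))"
  shows "poly_norm N J (\<lambda>\<alpha>. \<Sum>k\<in>UNIV. Qmap J (zmult k (P (g k))) \<alpha>)
    \<le> Qnorm N (Lambda m) J * (proj_norm (flat m J) (poly_norm N (flat m J)) P * (exp 1 * poly_norm N J c))"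
proof -
  let ?G = "flat m J" let ?pG = "poly_norm N ?G" let ?K = "dual_ball ?G ?pG"
  interpret G: coord_normed ?G ?pG by (rule coord_normed_poly[OF finite_flat])
  note PG = is_projectionD(1)[OF P]
  have zL: "zmult k (P (g k)) \<in> fvec (Lambda m)" for k
    by (rule zmult_fvec[OF PG[OF g] flat_subset assms(2)])
  have DG: "partial m J k c \<in> fvec ?G" for k by (rule is_op_fvec[OF is_op_partial assms(3)])
  have "(\<lambda>\<alpha>. \<Sum>k\<in>UNIV. Qmap J (zmult k (P (g k))) \<alpha>) = Qmap J (\<lambda>\<alpha>. \<Sum>k\<in>UNIV. zmult k (P (g k)) \<alpha>)"
    by (auto simp: Qmap_def fun_eq_iff)
  moreover have "poly_norm N J (Qmap J (\<lambda>\<alpha>. \<Sum>k\<in>UNIV. zmult k (P (g k)) \<alpha>))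
    \<le> Qnorm N (Lambda m) J * poly_norm N (Lambda m) (\<lambda>\<alpha>. \<Sum>k\<in>UNIV. zmult k (P (g k)) \<alpha>)"
    using zL by (intro Qnorm_upper[OF assms(1)] fvec_sum)
  moreover have "poly_norm N (Lambda m) (\<lambda>\<alpha>. \<Sum>k\<in>UNIV. zmult k (P (g k)) \<alpha>)
    \<le> proj_norm ?G ?pG P * (exp 1 * poly_norm N J c)"
  proof (rule poly_norm_least)
    fix z assume z: "N z \<le> 1"
    \<comment> \<open>With \<open>z\<close> frozen, its coordinates are scalars for
      \<open>P\<close>: the value at \<open>z\<close> of the sum of the z_k P(g_k) is the value of
      \<open>P h\<close> at the same point.\<close>
    define h where "h = (\<lambda>\<phi>. \<Sum>k\<in>UNIV. z k * g k \<phi>)"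
    have h: "h \<in> linf ?K" unfolding h_def using g by (intro csubspace_sum[OF csubspace_linf]) auto
    have Ph: "P h = (\<lambda>\<beta>. \<Sum>k\<in>UNIV. z k * P (g k) \<beta>)"
      unfolding h_def using g by (intro lin_on_sum[OF csubspace_linf is_projectionD(2)[OF P]]) auto
    have "peval (Lambda m) (\<lambda>\<alpha>. \<Sum>k\<in>UNIV. zmult k (P (g k)) \<alpha>) z = peval ?G (P h) z"
      unfolding Ph peval_sum peval_smult
      by (intro sum.cong peval_zmult[OF PG[OF g] flat_subset assms(2)] refl)
    also have "cmod \<dots> \<le> ?pG (P h)" by (rule poly_norm_upper[OF z])
    also have "\<dots> \<le> proj_norm ?G ?pG P * (exp 1 * poly_norm N J c)"
    proof (rule G.proj_norm_upper[OF P h])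
      fix \<phi> assume \<phi>: "\<phi> \<in> ?K"
      let ?d = "\<lambda>k. r \<phi> (partial m J k c)"
      \<comment> \<open>The coordinates of \<open>w\<close> have modulus at most those of
        \<open>z\<close> and carry the phases that make every \<open>w k * ?d k\<close> nonnegative.
        The sum of moduli becomes the value of the one functional \<open>r \<phi>\<close> at a
        normalized directional derivative.\<close>
      define w where "w k = complex_of_real (cmod (z k)) * cnj (sgn (?d k))" for k
      have "N w \<le> N z" by (rule N_mono) (auto simp: w_def norm_mult norm_sgn)
      then have w: "N w \<le> 1" using z by simp
      have wd: "w k * ?d k = complex_of_real (cmod (z k) * cmod (?d k))" for k
        unfolding w_def mult.assoc cnj_sgn_mult by simp
      let ?wD = "\<lambda>\<beta>. \<Sum>k\<in>UNIV. w k * partial m J k c \<beta>"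
      have "cmod (h \<phi>) \<le> (\<Sum>k\<in>UNIV. cmod (z k) * cmod (?d k))"
        unfolding h_def using gr[OF \<phi>] by (intro sum_norm_le) (auto simp: norm_mult intro: mult_left_mono)
      also have "\<dots> = cmod (complex_of_real (\<Sum>k\<in>UNIV. cmod (z k) * cmod (?d k)))"
        unfolding norm_of_real by (intro abs_of_nonneg[symmetric] sum_nonneg) auto
      also have "complex_of_real (\<Sum>k\<in>UNIV. cmod (z k) * cmod (?d k)) = (\<Sum>k\<in>UNIV. w k * ?d k)"
        unfolding wd by simp
      also have "\<dots> = r \<phi> ?wD"
        using DG by (intro lin_functional_sum[OF dual_ballD(1)[OF r[OF \<phi>]], symmetric]) auto
      also have "cmod (r \<phi> ?wD) \<le> ?pG ?wD"
        using DG by (intro dual_ballD(2)[OF r[OF \<phi>]] fvec_sum fvec_smult)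
      also have "?pG ?wD \<le> exp 1 * poly_norm N J c"
      proof (rule poly_norm_least)
        fix y assume y: "N y \<le> 1"
        show "cmod (peval ?G ?wD y) \<le> exp 1 * poly_norm N J c"
          unfolding peval_sum peval_smult by (rule norm_partial_le[OF assms(1-3) y w])
      qed
      finally show "cmod (h \<phi>) \<le> exp 1 * poly_norm N J c" .
    qed
    finally show "cmod (peval (Lambda m) (\<lambda>\<alpha>. \<Sum>k\<in>UNIV. zmult k (P (g k)) \<alpha>) z)
      \<le> proj_norm ?G ?pG P * (exp 1 * poly_norm N J c)" .
  qed
  then have "Qnorm N (Lambda m) J * poly_norm N (Lambda m) (\<lambda>\<alpha>. \<Sum>k\<in>UNIV. zmult k (P (g k)) \<alpha>)
    \<le> Qnorm N (Lambda m) J * (proj_norm ?G ?pG P * (exp 1 * poly_norm N J c))"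
    using Qnorm_nonneg[OF assms(1)] by (rule mult_left_mono)
  ultimately show ?thesis by simp
qed

lemma l1_factor_homogeneous:
  assumes "J \<subseteq> Lambda m" "1 \<le> m" "coord_normed T q"
    and u: "is_op J T u" "summing J (poly_norm N J) T q u C" and "\<epsilon> > 0"
  shows "l1_factor J (poly_norm N J) T q u (exp 1 * Qnorm N (Lambda m) J * lambda_poly N (flat m J) * C + \<epsilon>)"
proof -
  let ?G = "flat m J" let ?pG = "poly_norm N ?G"
  have fJ: "finite J" by (rule finite_subset[OF assms(1) finite_Lambda])
  interpret G: coord_normed ?G ?pG by (rule coord_normed_poly[OF finite_flat])
  have C: "C \<ge> 0" using u(2) by (simp add: summing_def)
  define E where "E = exp 1 * Qnorm N (Lambda m) J * C"
  have E: "E \<ge> 0" using C Qnorm_nonneg[OF assms(1)] by (simp add: E_def)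
  \<comment> \<open>Half of \<epsilon> pays for the finite net, the other half for the excess of
    \<open>P\<close> over the projection constant, which is multiplied by \<open>E\<close>.\<close>
  have "\<epsilon> / (2 * (E + 1)) > 0" using E \<open>\<epsilon> > 0\<close> by simp
  then obtain P where P: "is_projection ?G ?pG P" "proj_norm ?G ?pG P < lambda_poly N ?G + \<epsilon> / (2 * (E + 1))"
    unfolding lambda_poly_def by (rule G.proj_const_approx)
  let ?B = "exp 1 * Qnorm N (Lambda m) J * proj_norm ?G ?pG P"
  have "l1_factor J (poly_norm N J) T q u (?B * C + \<epsilon> / 2)"
  proof (rule l1_factor_via_projection[OF coord_normed_poly[OF fJ] G.coord_normed_axioms assms(3) P(1), of UNIV "partial m J"
        "\<lambda>k d. Qmap J (zmult k d)"])
    fix x g r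
    assume *: "x \<in> fvec J" "\<And>k. k \<in> UNIV \<Longrightarrow> g k \<in> linf (dual_ball ?G ?pG)"
      "\<And>\<phi>. \<phi> \<in> dual_ball ?G ?pG \<Longrightarrow> r \<phi> \<in> dual_ball ?G ?pG"
      "\<And>k \<phi>. k \<in> UNIV \<Longrightarrow> \<phi> \<in> dual_ball ?G ?pG \<Longrightarrow> cmod (g k \<phi>) \<le> cmod (r \<phi> (partial m J k x))"
    have "poly_norm N J (\<lambda>\<alpha>. \<Sum>k\<in>UNIV. Qmap J (zmult k (P (g k))) \<alpha>)
      \<le> Qnorm N (Lambda m) J * (proj_norm ?G ?pG P * (exp 1 * poly_norm N J x))"
      by (rule zmult_projection_bound[OF assms(1,2) *(1) P(1), where r = r]) (use *(2-4) in auto)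
    then show "poly_norm N J (\<lambda>\<alpha>. \<Sum>k\<in>UNIV. Qmap J (zmult k (P (g k))) \<alpha>) \<le> ?B * poly_norm N J x"
      by (simp add: mult_ac)
  qed (use u \<open>\<epsilon> > 0\<close> in \<open>auto simp: is_op_partial is_op_zmult euler[OF assms(1,2)]\<close>)
  moreover have "?B * C + \<epsilon> / 2 \<le> exp 1 * Qnorm N (Lambda m) J * lambda_poly N ?G * C + \<epsilon>"
  proof -
    have "E * proj_norm ?G ?pG P \<le> E * (lambda_poly N ?G + \<epsilon> / (2 * (E + 1)))"
      using P(2) E by (intro mult_left_mono) auto
    also have "E * (lambda_poly N ?G + \<epsilon> / (2 * (E + 1))) = E * lambda_poly N ?G + E / (E + 1) * (\<epsilon> / 2)"
      using E by (simp add: field_simps)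
    also have "\<dots> \<le> E * lambda_poly N ?G + 1 * (\<epsilon> / 2)"
      using E \<open>\<epsilon> > 0\<close> by (intro add_left_mono mult_right_mono) auto
    finally show ?thesis by (simp add: E_def mult_ac)
  qed
  ultimately show ?thesis by (rule l1_factor_mono[OF coord_normed_poly[OF fJ]])
qed

lemma gl_poly_homogeneous:
  assumes "J \<subseteq> Lambda m" "1 \<le> m"
  shows "gl_poly N J \<le> exp 1 * Qnorm N (Lambda m) J * lambda_poly N (flat m J)"
  unfolding gl_poly_def
proof (rule coord_normed.gl_const_le)
  show "coord_normed J (poly_norm N J)"
    by (rule coord_normed_poly[OF finite_subset[OF assms(1) finite_Lambda]])
  show "0 \<le> exp 1 * Qnorm N (Lambda m) J * lambda_poly N (flat m J)"
    using Qnorm_nonneg[OF assms(1)] lambda_poly_nonneg by simp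
qed (rule l1_factor_homogeneous[OF assms coord_normed_l2])

text \<open>In degree zero there is no variable to split off. The only possible multi-index is zero,
  so the space has dimension at most one and a rank-one factorization is enough.\<close>

lemma l1_factor_constants:
  assumes "J \<subseteq> Lambda 0" "coord_normed T q"
    and u: "is_op J T u" "summing J (poly_norm N J) T q u C"
  shows "l1_factor J (poly_norm N J) T q u C"
proof -
  have fJ: "finite J" by (rule finite_subset[OF assms(1) finite_Lambda])
  interpret J: coord_normed J "poly_norm N J" by (rule coord_normed_poly[OF fJ])
  have eq0: "\<alpha> = (\<lambda>_. 0)" if "\<alpha> \<in> J" for \<alpha>
    using that assms(1) by (auto simp: Lambda_def Defs.order_def fun_eq_iff)
  have m1: "monom z \<alpha> = 1" if "\<alpha> \<in> J" for z \<alpha> using eq0[OF that] by (simp add: Defs.monom_def)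
  have le: "cmod (x \<alpha>) \<le> poly_norm N J x" if "\<alpha> \<in> J" for x \<alpha>
  proof -
    have "J = {\<alpha>}" using eq0 that by blast
    then have "peval J x (\<lambda>_. 0) = x \<alpha>" using m1[OF that] by (simp add: peval_def)
    then show ?thesis using poly_norm_upper[of "\<lambda>_. 0" J x] N_zero by simp
  qed
  have C: "C \<ge> 0" using u(2) by (simp add: summing_def)
  show ?thesis
  proof (rule l1_factorI[of J _ "\<lambda>\<alpha> x. x \<alpha>" "\<lambda>\<alpha>. u (unitv \<alpha>)"])
    fix x assume x: "x \<in> fvec J"
    show "u x = (\<lambda>b. \<Sum>\<alpha>\<in>J. x \<alpha> * u (unitv \<alpha>) b)"
      using is_op_sum[OF u(1) fJ, of unitv x] fvec_expand[OF fJ x] by simp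
    show "(\<Sum>\<alpha>\<in>J. cmod (x \<alpha>) * q (u (unitv \<alpha>))) \<le> C * poly_norm N J x"
    proof (cases "J = {}")
      case False
      then obtain \<alpha> where \<alpha>: "J = {\<alpha>}" using eq0 by blast
      \<comment> \<open>The summing property for a family of one vector, the constant polynomial
        1.\<close>
      have "(\<Sum>i\<in>{()}. q (u (unitv \<alpha>))) \<le> C * 1"
      proof (rule J.summing_unimodular_le[OF u(2)])
        fix e :: "unit \<Rightarrow> complex" assume e: "\<And>i. cmod (e i) \<le> 1"
        show "poly_norm N J (\<lambda>a. \<Sum>i\<in>{()}. e i * unitv \<alpha> a) \<le> 1"
          by (rule poly_norm_least) (use e m1 \<alpha> in \<open>simp add: peval_def unitv_def\<close>)
      qed (use \<alpha> in auto)
      then have "cmod (x \<alpha>) * q (u (unitv \<alpha>)) \<le> poly_norm N J x * C"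
        using le[of \<alpha> x] \<alpha> C assms(2) u(1) J.nonneg[OF x]
        by (intro mult_mono') (auto intro!: coord_normed.nonneg[OF assms(2)] is_op_fvec[OF u(1)])
      then show ?thesis by (simp add: \<alpha> mult.commute)
    qed (use C J.nonneg[OF x] in auto)
  qed (use fJ u(1) in \<open>auto simp: lin_functional_def is_op_def\<close>)
qed

text \<open>The maxima start at k = 1, yet there are \<open>m + 1\<close> homogeneous parts. An
  element of order \<open>m\<close> makes both maxima at least 1, so the bound \<open>C\<close> for
  the constant part is below the common bound of the others.\<close>

lemma gl_poly_degree:
  assumes "1 \<le> m" and deg: "\<And>\<alpha>. \<alpha> \<in> J \<Longrightarrow> order \<alpha> \<le> m" and top: "\<exists>\<alpha>\<in>J. order \<alpha> = m"
  shows "gl_poly N J \<le> exp 1 * real (m + 1)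
     * (MAX k\<in>{1..m}. Qnorm N (Lambda k) (Jpart J k)) * (MAX k\<in>{1..m}. lambda_poly N (flat k (Jpart J k)))"
    (is "_ \<le> exp 1 * real (m + 1) * ?Q * ?L")
  unfolding gl_poly_def
proof (rule coord_normed.gl_const_le)
  have fJ: "finite J" by (rule finite_subset[OF _ finite_order_le[of m]]) (use deg in auto)
  show cJ: "coord_normed J (poly_norm N J)" by (rule coord_normed_poly[OF fJ])
  interpret J: coord_normed J "poly_norm N J" by fact
  have sub: "Jpart J k \<subseteq> Lambda k" "Jpart J k \<subseteq> J" for k by (auto simp: Jpart_def)
  have fk: "finite (Jpart J k)" for k using finite_subset[OF sub(2) fJ] .
  have Q: "Qnorm N (Lambda k) (Jpart J k) \<le> ?Q" and L: "lambda_poly N (flat k (Jpart J k)) \<le> ?L"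
    if "1 \<le> k" "k \<le> m" for k using that by (auto intro!: Max_ge)
  obtain \<alpha> where \<alpha>: "\<alpha> \<in> J" "order \<alpha> = m" using top by blast
  then have \<alpha>m: "\<alpha> \<in> Jpart J m" by (simp add: Jpart_def Lambda_def)
  have "1 \<le> Qnorm N (Lambda m) (Jpart J m)" using \<alpha>m by (intro Qnorm_ge_1 sub(1)) auto
  then have Q1: "1 \<le> ?Q" using Q[OF assms(1) order_refl] by (rule order_trans)
  have "1 \<le> lambda_poly N (flat m (Jpart J m))"
    unfolding lambda_poly_def
    by (rule coord_normed.proj_const_ge_1[OF coord_normed_poly[OF finite_flat] flat_nonempty[OF \<alpha>m \<alpha>(2) assms(1)]])
  then have L1: "1 \<le> ?L" using L[OF assms(1) order_refl] by (rule order_trans)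
  show "0 \<le> exp 1 * real (m + 1) * ?Q * ?L" using Q1 L1 by simp
  fix M u C and \<epsilon> :: real
  assume u: "is_op J {..<M} u" "summing J (poly_norm N J) {..<M} (l2norm M) u C" and "\<epsilon> > 0"
  have C: "C \<ge> 0" using u(2) by (simp add: summing_def)
  \<comment> \<open>Each of the \<open>m + 1\<close> homogeneous parts contributes the error
    \<delta>.\<close>
  define \<delta> where "\<delta> = \<epsilon> / real (m + 1)"
  have \<delta>: "\<delta> > 0" using \<open>\<epsilon> > 0\<close> by (simp add: \<delta>_def)
  let ?D = "exp 1 * ?Q * ?L * C + \<delta>"
  have part: "l1_factor J (poly_norm N J) {..<M} (l2norm M) (\<lambda>x. u (Qmap (Jpart J k) x)) ?D" if k: "k \<le> m" for k
  proof (rule l1_factor_compose[where u = u and v = "Qmap (Jpart J k)" and S = "Jpart J k" and p = "poly_norm N (Jpart J k)"])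
    let ?I = "Jpart J k"
    show cI: "coord_normed ?I (poly_norm N ?I)" by (rule coord_normed_poly[OF fk])
    have uI: "is_op ?I {..<M} u" using u(1) fvec_mono[OF sub(2)] unfolding is_op_def by blast
    have sI: "summing ?I (poly_norm N ?I) {..<M} (l2norm M) u C"
      by (rule J.summing_restrict[OF u(2) cI sub(2) poly_norm_superset[OF fJ sub(2)]])
    have "\<exists>D. l1_factor ?I (poly_norm N ?I) {..<M} (l2norm M) u D \<and> D \<le> ?D"
    proof (cases "k = 0")
      case True
      have "1 * 1 * 1 * C \<le> exp 1 * ?Q * ?L * C"
        using Q1 L1 C by (intro mult_mono) auto
      then show ?thesis using l1_factor_constants[OF _ coord_normed_l2 uI sI] sub(1)[of k] True \<delta>
        by (intro exI[of _ C]) auto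
    next
      case False
      then have k1: "1 \<le> k" by simp
      have "exp 1 * Qnorm N (Lambda k) ?I * lambda_poly N (flat k ?I) * C \<le> exp 1 * ?Q * ?L * C"
        using Q[OF k1 k] L[OF k1 k] Q1 C lambda_poly_nonneg
        by (intro mult_right_mono mult_mono mult_left_mono) auto
      then show ?thesis
        using l1_factor_homogeneous[OF sub(1) k1 coord_normed_l2 uI sI \<delta>]
        by (intro exI conjI) auto
    qed
    then show "l1_factor ?I (poly_norm N ?I) {..<M} (l2norm M) u ?D"
      using l1_factor_mono[OF cI] by blast
    show "0 \<le> ?D" using Q1 L1 C \<delta> by simp
    show "is_op J ?I (Qmap ?I)" by (rule is_op_Qmap)
    show "poly_norm N ?I (Qmap ?I x) \<le> poly_norm N J x" for x
      by (rule poly_norm_homogeneous_part[OF fJ deg k])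
  qed
  have "l1_factor J (poly_norm N J) {..<M} (l2norm M) (\<lambda>x b. \<Sum>k\<in>{..m}. u (Qmap (Jpart J k) x) b) (\<Sum>k\<in>{..m}. ?D)"
    by (rule l1_factor_sum) (use part in auto)
  moreover have "(\<lambda>b. \<Sum>k\<in>{..m}. u (Qmap (Jpart J k) x) b) = u x" if x: "x \<in> fvec J" for x
  proof -
    have "(\<lambda>\<alpha>. \<Sum>k\<in>{..m}. 1 * Qmap (Jpart J k) x \<alpha>) = x"
    proof
      fix \<alpha>
      show "(\<Sum>k\<in>{..m}. 1 * Qmap (Jpart J k) x \<alpha>) = x \<alpha>"
      proof (cases "\<alpha> \<in> J")
        case True
        have "(\<Sum>k\<in>{..m}. 1 * Qmap (Jpart J k) x \<alpha>) = (\<Sum>k\<in>{..m}. if k = order \<alpha> then x \<alpha> else 0)"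
          using True by (intro sum.cong) (auto simp: Qmap_def Jpart_def Lambda_def)
        then show ?thesis using deg[OF True] by simp
      qed (use x in \<open>auto simp: Qmap_def Jpart_def fvec_def intro!: sum.neutral\<close>)
    qed
    moreover have "u (\<lambda>\<alpha>. \<Sum>k\<in>{..m}. 1 * Qmap (Jpart J k) x \<alpha>) = (\<lambda>b. \<Sum>k\<in>{..m}. 1 * u (Qmap (Jpart J k) x) b)"
      by (rule is_op_sum[OF u(1)]) (auto simp: Qmap_def fvec_def Jpart_def)
    ultimately show ?thesis by simp
  qed
  ultimately have "l1_factor J (poly_norm N J) {..<M} (l2norm M) u (\<Sum>k\<in>{..m}. ?D)"
    by (rule l1_factor_cong)
  moreover have "(\<Sum>k\<in>{..m}. ?D) = exp 1 * real (m + 1) * ?Q * ?L * C + \<epsilon>"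
    by (simp add: \<delta>_def distrib_left) (simp add: algebra_simps)
  ultimately show "l1_factor J (poly_norm N J) {..<M} (l2norm M) u (exp 1 * real (m + 1) * ?Q * ?L * C + \<epsilon>)" by simp
qed

end

theorem theorem2p6:
  fixes N :: "('n::finite \<Rightarrow> complex) \<Rightarrow> real"
  assumes "banach_lattice N"
  shows "(\<forall>(m::nat) (J::('n \<Rightarrow> nat) set). 1 \<le> m \<longrightarrow> J \<subseteq> Lambda m \<longrightarrow>
            gl_poly N J \<le> exp 1 * Qnorm N (Lambda m) J * lambda_poly N (flat m J))
       \<and> (\<forall>(m::nat) (J::('n \<Rightarrow> nat) set). 1 \<le> m \<longrightarrow> (\<forall>\<alpha>\<in>J. order \<alpha> \<le> m) \<longrightarrow> (\<exists>\<alpha>\<in>J. order \<alpha> = m) \<longrightarrow>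
            gl_poly N J \<le> exp 1 * real (m + 1)
              * (MAX k\<in>{1..m}. Qnorm N (Lambda k) (Jpart J k))
              * (MAX k\<in>{1..m}. lambda_poly N (flat k (Jpart J k))))"
proof (intro conjI allI impI)
  interpret lattice_norm N by (rule lattice_norm.intro[OF assms])
  fix m :: nat and J :: "('n \<Rightarrow> nat) set"
  assume m: "1 \<le> m"
  show "gl_poly N J \<le> exp 1 * Qnorm N (Lambda m) J * lambda_poly N (flat m J)" if "J \<subseteq> Lambda m"
    by (rule gl_poly_homogeneous[OF that m])
  show "gl_poly N J \<le> exp 1 * real (m + 1)
      * (MAX k\<in>{1..m}. Qnorm N (Lambda k) (Jpart J k))
      * (MAX k\<in>{1..m}. lambda_poly N (flat k (Jpart J k)))"
    if "\<forall>\<alpha>\<in>J. order \<alpha> \<le> m" "\<exists>\<alpha>\<in>J. order \<alpha> = m"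
    by (rule gl_poly_degree[OF m bspec[OF that(1)] that(2)])
qed

end
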